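(* There is an $\omega_1$-compact Type I surface $S$ spanned by directions such that $\langle\mathfrak{D}_S,\preceq\rangle$ is isomorphic to $\langle\mathbb{Z},\le\rangle$. In particular, there is neither a ufo-minimal nor a ufo-maximal direction in $S$.
   Context: All spaces are Hausdorff and all functions are continuous unless otherwise specified. A space $X$ is Type I if $X=\bigcup_{\alpha<\omega_1}X_\alpha$ with each $X_\alpha$ open, $\overline{X_\alpha}$ Lindelöf, and $\overline{X_\alpha}\subset X_\beta$ whenever $\alpha<\beta$; Type I spaces are always assumed non-Lindelöf. A subset of a Type I space is bounded if it is contained in some $X_\alpha$, otherwise unbounded; a function into a Type I space is (un)bounded if its range is. Club means closed and unbounded. $\mathbb{L}_{\ge 0}$ is the closed long ray $\omega_1\times[0,1)$ with the lexicographic order topology (with $X_\alpha=[0,\alpha)$). For subsets $A,B$ of a Type I space $X$, write $A\preceq B$ (the unbounded function order, ufo) if for every continuous $f:X\to\mathbb{L}_{\ge 0}$, $f|_A$ unbounded implies $f|_B$ unbounded; $A,B$ are ufo-equivalent if $A\preceq B\preceq A$. A direction in $X$ is a club $D\subset X$ which is ufo-equivalent to each of its club subsets. $\langle\mathfrak{D}_X,\preceq\rangle$ is the poset of ufo-equivalence classes of directions in $X$; a direction is ufo-minimal (ufo-maximal) if its class is minimal (maximal) in $\langle\mathfrak{D}_X,\preceq\rangle$. An open subset of a Type I space is large if it contains a club set; a Type I space is spanned by directions if every large open subset contains a direction (of the whole space). A space is $\omega_1$-compact if it contains no uncountable closed discrete subset. A surface is a 2-dimensional manifold, with or without boundary (connected,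 Hausdorff). *)

theory Defs
  imports "HOL-Analysis.Analysis"
begin

section \<open>The first uncountable ordinal\<close>

typedef omega1 = "Field (cardSuc natLeq)"
  using Field_cardSuc_not_empty natLeq_Card_order by blast

lemma wo_rel_cardSuc_natLeq: "wo_rel (cardSuc natLeq)"
  using cardSuc_Well_order natLeq_Card_order by (simp add: wo_rel_def)

instantiation omega1 :: wellorder
begin

definition less_eq_omega1 :: "omega1 \<Rightarrow> omega1 \<Rightarrow> bool" where
  "a \<le> b \<longleftrightarrow> (Rep_omega1 a, Rep_omega1 b) \<in> cardSuc natLeq"

definition less_omega1 :: "omega1 \<Rightarrow> omega1 \<Rightarrow> bool" where
  "(a :: omega1) < b \<longleftrightarrow> a \<le> b \<and> \<not> b \<le> a"

instance
proof
  fix x y z :: omega1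
  show "x < y \<longleftrightarrow> x \<le> y \<and> \<not> y \<le> x"
    by (rule less_omega1_def)
  show "x \<le> x"
    unfolding less_eq_omega1_def
    using wo_rel.REFL[OF wo_rel_cardSuc_natLeq] Rep_omega1 by (auto simp: refl_on_def)
  show "x \<le> y \<Longrightarrow> y \<le> z \<Longrightarrow> x \<le> z"
    unfolding less_eq_omega1_def
    using wo_rel.TRANS[OF wo_rel_cardSuc_natLeq] by (meson transD)
  show "x \<le> y \<Longrightarrow> y \<le> x \<Longrightarrow> x = y"
    unfolding less_eq_omega1_def
    using wo_rel.ANTISYM[OF wo_rel_cardSuc_natLeq] by (meson Rep_omega1_inject antisymD)
  show "x \<le> y \<or> y \<le> x"
    unfolding less_eq_omega1_def
    using wo_rel.TOTALS[OF wo_rel_cardSuc_natLeq] Rep_omega1 by blast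
next
  fix P :: "omega1 \<Rightarrow> bool" and a
  assume step: "\<And>x. (\<And>y. y < x \<Longrightarrow> P y) \<Longrightarrow> P x"
  have "\<forall>u. Rep_omega1 u = v \<longrightarrow> P u" for v
  proof (induction v rule: wo_rel.well_order_induct[OF wo_rel_cardSuc_natLeq])
    case (1 v)
    show ?case
    proof (intro allI impI)
      fix u assume u: "Rep_omega1 u = v"
      show "P u"
      proof (rule step)
        fix y assume "y < u"
        then have "Rep_omega1 y \<noteq> v \<and> (Rep_omega1 y, v) \<in> cardSuc natLeq"
          using u unfolding less_omega1_def less_eq_omega1_def by auto
        then show "P y" using 1 by blast
      qed
    qed
  qed
  then show "P a" by blast
qed

end

text \<open>Up to order isomorphism, a well-order is \<open>\<omega>\<^sub>1\<close> exactly when it is uncountable and all its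
  proper initial segments are countable.\<close>

lemma bij_betw_Rep_omega1: "bij_betw Rep_omega1 UNIV (Field (cardSuc natLeq))"
  using type_definition.Rep_range[OF type_definition_omega1] Rep_omega1_inject
  by (auto simp: bij_betw_def inj_on_def)

lemma countable_iff_ordLess_cardSuc:
  includes cardinal_syntax
  shows "countable A \<longleftrightarrow> |A| <o cardSuc natLeq"
proof -
  have "countable A \<longleftrightarrow> |A| \<le>o |UNIV :: nat set|"
    unfolding countable_def card_of_ordLeq[symmetric] by auto
  also have "\<dots> \<longleftrightarrow> |A| \<le>o natLeq"
    by (meson card_of_nat ordIso_symmetric ordLeq_ordIso_trans)
  also have "\<dots> \<longleftrightarrow> |A| <o cardSuc natLeq"
    using cardSuc_ordLeq_ordLess[OF natLeq_Card_order card_of_Card_order] by blast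
  finally show ?thesis .
qed

lemma uncountable_UNIV_omega1:
  includes cardinal_syntax
  shows "uncountable (UNIV :: omega1 set)"
proof
  assume "countable (UNIV :: omega1 set)"
  then have "countable (Field (cardSuc natLeq))"
    using bij_betw_Rep_omega1 by (metis bij_betw_imp_surj_on countable_image)
  then have "|Field (cardSuc natLeq)| <o cardSuc natLeq"
    using countable_iff_ordLess_cardSuc by blast
  then show False
    using card_of_Field_ordIso[OF cardSuc_Card_order[OF natLeq_Card_order]]
      not_ordLess_ordIso by blast
qed

lemma countable_lessThan_omega1:
  includes cardinal_syntax
  shows "countable {..<a :: omega1}"
proof -
  have "|underS (cardSuc natLeq) (Rep_omega1 a)| <o cardSuc natLeq"
    using card_of_underS[OF cardSuc_Card_order[OF natLeq_Card_order]] Rep_omega1 by blast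
  then have "countable (underS (cardSuc natLeq) (Rep_omega1 a))"
    using countable_iff_ordLess_cardSuc by blast
  moreover have "Rep_omega1 ` {..<a} \<subseteq> underS (cardSuc natLeq) (Rep_omega1 a)"
    by (auto simp: underS_def less_omega1_def less_eq_omega1_def)
  ultimately have "countable (Rep_omega1 ` {..<a})"
    using countable_subset by blast
  then show ?thesis
    by (rule countable_image_inj_on) (simp add: inj_on_def Rep_omega1_inject)
qed

lemma countable_bounded_omega1:
  assumes "countable (A :: omega1 set)"
  obtains b where "\<And>a. a \<in> A \<Longrightarrow> a < b"
proof -
  have "countable (\<Union>a\<in>A. {..a})"
    using assms countable_lessThan_omega1
    by (intro countable_UN) (auto simp: ivl_disj_un(2)[symmetric])
  then have "(\<Union>a\<in>A. {..a}) \<noteq> UNIV"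
    using uncountable_UNIV_omega1 by metis
  then obtain b where "\<And>a. a \<in> A \<Longrightarrow> \<not> b \<le> a" by blast
  then show thesis using that[of b] by (simp add: not_le)
qed

section \<open>The closed long ray\<close>

typedef long_ray = "(UNIV :: omega1 set) \<times> {0..<1::real}"
  by (auto intro!: exI[of _ 0])

instantiation long_ray :: linorder
begin

definition less_eq_long_ray :: "long_ray \<Rightarrow> long_ray \<Rightarrow> bool" where
  "x \<le> y \<longleftrightarrow> fst (Rep_long_ray x) < fst (Rep_long_ray y) \<or>
     fst (Rep_long_ray x) = fst (Rep_long_ray y) \<and> snd (Rep_long_ray x) \<le> snd (Rep_long_ray y)"

definition less_long_ray :: "long_ray \<Rightarrow> long_ray \<Rightarrow> bool" where
  "(x :: long_ray) < y \<longleftrightarrow> x \<le> y \<and> \<not> y \<le> x"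

instance
  by standard
    (auto simp: less_eq_long_ray_def less_long_ray_def Rep_long_ray_inject[symmetric] prod_eq_iff)

end

instantiation long_ray :: linorder_topology
begin

definition open_long_ray :: "long_ray set \<Rightarrow> bool" where
  "open_long_ray = generate_topology (range (\<lambda>a. {..<a}) \<union> range (\<lambda>a. {a<..}))"

instance
  by standard (rule open_long_ray_def)

end

definition ordinal_ray :: "omega1 \<Rightarrow> long_ray" where
  "ordinal_ray \<alpha> = Abs_long_ray (\<alpha>, 0)"

definition bounded_long_ray :: "long_ray set \<Rightarrow> bool" where
  "bounded_long_ray A \<longleftrightarrow> (\<exists>\<alpha>. A \<subseteq> {..<ordinal_ray \<alpha>})"

section \<open>Type I spaces\<close>

definition typeI_cover :: "'a topology \<Rightarrow> (omega1 \<Rightarrow> 'a set) \<Rightarrow> bool" where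
  "typeI_cover X U \<longleftrightarrow>
     topspace X = (\<Union>\<alpha>. U \<alpha>) \<and>
     (\<forall>\<alpha>. openin X (U \<alpha>)) \<and>
     (\<forall>\<alpha>. Lindelof_space (subtopology X (X closure_of U \<alpha>))) \<and>
     (\<forall>\<alpha> \<beta>. \<alpha> < \<beta> \<longrightarrow> X closure_of U \<alpha> \<subseteq> U \<beta>)"

definition typeI_space :: "'a topology \<Rightarrow> bool" where
  "typeI_space X \<longleftrightarrow>
     Hausdorff_space X \<and> (\<exists>U. typeI_cover X U) \<and> \<not> Lindelof_space X"

text \<open>By \<open>bounded_in_iff\<close> below, boundedness does not depend on the choice of the cover.\<close>

definition bounded_in :: "'a topology \<Rightarrow> 'a set \<Rightarrow> bool" where
  "bounded_in X A \<longleftrightarrow> (\<exists>U. typeI_cover X U \<and> (\<exists>\<alpha>. A \<subseteq> U \<alpha>))"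

lemma typeI_cover_mono:
  assumes "typeI_cover X U" "\<alpha> \<le> \<beta>"
  shows "U \<alpha> \<subseteq> U \<beta>"
proof (cases "\<alpha> = \<beta>")
  case False
  then have "X closure_of U \<alpha> \<subseteq> U \<beta>" "U \<alpha> \<subseteq> topspace X"
    using assms openin_subset[of X "U \<alpha>"] unfolding typeI_cover_def by auto
  then show ?thesis using closure_of_subset by blast
qed simp

lemma typeI_cover_cofinal:
  assumes U: "typeI_cover X U" and V: "typeI_cover X V"
  shows "\<exists>\<beta>. V \<alpha> \<subseteq> U \<beta>"
proof -
  let ?C = "X closure_of V \<alpha>"
  have sub: "?C \<subseteq> topspace X" by (rule closure_of_subset_topspace)
  have "V \<alpha> \<subseteq> ?C"
    using V openin_subset[of X "V \<alpha>"] unfolding typeI_cover_def by (simp add: closure_of_subset)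
  have "Lindelof_space (subtopology X ?C)" using V unfolding typeI_cover_def by blast
  then obtain \<V> where \<V>: "countable \<V>" "\<V> \<subseteq> range U" "?C \<subseteq> \<Union>\<V>"
    using U sub unfolding Lindelof_space_subtopology_subset[OF sub] typeI_cover_def
    by (smt (verit) rangeE)
  from \<V>(1,2) obtain I where I: "countable I" "\<V> = U ` I"
    by (metis countable_subset_image)
  obtain b where b: "\<And>a. a \<in> I \<Longrightarrow> a < b" using countable_bounded_omega1[OF I(1)] by blast
  have "\<Union>\<V> \<subseteq> U b"
    using I(2) b typeI_cover_mono[OF U] by (fastforce dest: less_imp_le)
  then show ?thesis using \<V>(3) \<open>V \<alpha> \<subseteq> ?C\<close> by blast
qed

lemma bounded_in_iff:
  assumes "typeI_cover X U"
  shows "bounded_in X A \<longleftrightarrow> (\<exists>\<alpha>. A \<subseteq> U \<alpha>)"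
  unfolding bounded_in_def using assms typeI_cover_cofinal by (metis subset_trans)

definition club_in :: "'a topology \<Rightarrow> 'a set \<Rightarrow> bool" where
  "club_in X C \<longleftrightarrow> closedin X C \<and> \<not> bounded_in X C"

definition large_open :: "'a topology \<Rightarrow> 'a set \<Rightarrow> bool" where
  "large_open X W \<longleftrightarrow> openin X W \<and> (\<exists>C. club_in X C \<and> C \<subseteq> W)"

definition omega1_compact :: "'a topology \<Rightarrow> bool" where
  "omega1_compact X \<longleftrightarrow>
     \<not> (\<exists>C. closedin X C \<and> subtopology X C = discrete_topology C \<and> uncountable C)"

section \<open>The unbounded function order and directions\<close>

definition ufo_le :: "'a topology \<Rightarrow> 'a set \<Rightarrow> 'a set \<Rightarrow> bool" where
  "ufo_le X A B \<longleftrightarrow>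
     (\<forall>f :: 'a \<Rightarrow> long_ray. continuous_map X euclidean f \<longrightarrow>
        \<not> bounded_long_ray (f ` A) \<longrightarrow> \<not> bounded_long_ray (f ` B))"

definition ufo_equiv :: "'a topology \<Rightarrow> 'a set \<Rightarrow> 'a set \<Rightarrow> bool" where
  "ufo_equiv X A B \<longleftrightarrow> ufo_le X A B \<and> ufo_le X B A"

definition direction :: "'a topology \<Rightarrow> 'a set \<Rightarrow> bool" where
  "direction X D \<longleftrightarrow>
     club_in X D \<and> (\<forall>C. club_in X C \<and> C \<subseteq> D \<longrightarrow> ufo_equiv X D C)"

definition spanned_by_directions :: "'a topology \<Rightarrow> bool" where
  "spanned_by_directions X \<longleftrightarrow>
     (\<forall>W. large_open X W \<longrightarrow> (\<exists>D. direction X D \<and> D \<subseteq> W))"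

definition ufo_class :: "'a topology \<Rightarrow> 'a set \<Rightarrow> 'a set set" where
  "ufo_class X D = {E. direction X E \<and> ufo_equiv X D E}"

definition direction_classes :: "'a topology \<Rightarrow> 'a set set set" where
  "direction_classes X = ufo_class X ` {D. direction X D}"

definition class_le :: "'a topology \<Rightarrow> 'a set set \<Rightarrow> 'a set set \<Rightarrow> bool" where
  "class_le X P Q \<longleftrightarrow> (\<exists>D\<in>P. \<exists>E\<in>Q. ufo_le X D E)"

lemma class_le_ufo_class:
  assumes "direction X D" "direction X E"
  shows "class_le X (ufo_class X D) (ufo_class X E) \<longleftrightarrow> ufo_le X D E"
  using assms unfolding class_le_def ufo_class_def ufo_equiv_def ufo_le_def by blast

definition ufo_minimal :: "'a topology \<Rightarrow> 'a set \<Rightarrow> bool" where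
  "ufo_minimal X D \<longleftrightarrow> direction X D \<and>
     (\<forall>P\<in>direction_classes X. class_le X P (ufo_class X D) \<longrightarrow> P = ufo_class X D)"

definition ufo_maximal :: "'a topology \<Rightarrow> 'a set \<Rightarrow> bool" where
  "ufo_maximal X D \<longleftrightarrow> direction X D \<and>
     (\<forall>P\<in>direction_classes X. class_le X (ufo_class X D) P \<longrightarrow> P = ufo_class X D)"

definition order_isomorphic ::
  "'a set \<Rightarrow> ('a \<Rightarrow> 'a \<Rightarrow> bool) \<Rightarrow> 'b set \<Rightarrow> ('b \<Rightarrow> 'b \<Rightarrow> bool) \<Rightarrow> bool" where
  "order_isomorphic A leA B leB \<longleftrightarrow>
     (\<exists>\<phi>. bij_betw \<phi> A B \<and> (\<forall>x\<in>A. \<forall>y\<in>A. leA x y \<longleftrightarrow> leB (\<phi> x) (\<phi> y)))"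

section \<open>Surfaces\<close>

text \<open>Boundary points are allowed, and second countability is not required. A
  surface of Type I has the cardinality of the continuum, so up to homeomorphism it lives on a
  subset of any type with at least that many elements: an existence statement about such surfaces
  does not depend on which type of this size carries them.\<close>

definition surface :: "'a topology \<Rightarrow> bool" where
  "surface X \<longleftrightarrow> Hausdorff_space X \<and> connected_space X \<and>
     (\<forall>x\<in>topspace X. \<exists>W V. openin X W \<and> x \<in> W \<and>
        openin (top_of_set {p :: real \<times> real. snd p \<ge> 0}) V \<and>
        subtopology X W homeomorphic_space top_of_set V)"

end

theory Submission
  imports Defs
begin

text \<open>
  Glue the octants \<open>{(x, y). y \<le> x}\<close> of the squared long ray, one for every integer, along
  their edges, the diagonal of the octant \<open>n\<close> being identified with the horizontal axis of the
  octant \<open>n + 1\<close>, and drop the common corner. The part below a fixed level is an open strip of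
  the plane. Every club set meets some horizontal ray in a club set: either it has an unbounded part of
  bounded height in some octant, and compactness yields a single height, or a leapfrog argument puts its
  limit points on a diagonal, which is a horizontal ray of the next octant. A continuous function unbounded
  on one horizontal ray of an octant is unbounded on all of them, because the set of such heights and its
  complement are closed, and hence by leapfrogging on the diagonal. It is therefore unbounded on the rays of
  all later octants. Conversely the height within the octant \<open>n\<close> is bounded on the rays of the
  octants up to \<open>n\<close> and unbounded on those of the octant \<open>n + 1\<close>. So the class of
  a direction is the integer \<open>n\<close> of the octant whose rays it meets in a club set.
\<close>

section \<open>Charts of the long ray\<close>

text \<open>An enumeration of \<open>A\<close> is injective, so the sum is dominated by a geometric
  series. This supplies positive weights of finite total on any countable set of ordinals.\<close>

lemma summable_powers_countable:
  assumes "countable A"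
  shows "(\<lambda>a. (1 / 2 :: real) ^ to_nat_on A a) summable_on A"
proof -
  have "(\<lambda>n. (1 / 2 :: real) ^ n) summable_on UNIV"
    by (rule norm_summable_imp_summable_on) (simp add: summable_geometric)
  then have "(\<lambda>n. (1 / 2 :: real) ^ n) summable_on to_nat_on A ` A"
    by (rule summable_on_subset_banach) simp
  then show ?thesis
    by (simp add: summable_on_reindex[OF inj_on_to_nat_on[OF assms]] comp_def)
qed

lemma less_long_ray_iff:
  "x < y \<longleftrightarrow> fst (Rep_long_ray x) < fst (Rep_long_ray y) \<or>
     fst (Rep_long_ray x) = fst (Rep_long_ray y) \<and> snd (Rep_long_ray x) < snd (Rep_long_ray y)"
  by (auto simp: less_long_ray_def less_eq_long_ray_def)

lemma snd_Rep_long_ray: "0 \<le> snd (Rep_long_ray x)" "snd (Rep_long_ray x) < 1"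
  using Rep_long_ray[of x] by (auto simp: mem_Times_iff)

lemma Rep_ordinal_ray: "Rep_long_ray (ordinal_ray \<alpha>) = (\<alpha>, 0)"
  unfolding ordinal_ray_def by (rule Abs_long_ray_inverse) simp

lemma less_ordinal_ray_iff: "x < ordinal_ray \<alpha> \<longleftrightarrow> fst (Rep_long_ray x) < \<alpha>"
  using snd_Rep_long_ray[of x] by (auto simp: less_long_ray_iff Rep_ordinal_ray)

text \<open>Attaching a weight \<open>w \<gamma> > 0\<close> with finite total to every \<open>\<gamma> < \<alpha>\<close>, the point \<open>(\<beta>, t)\<close> is sent
  to \<open>(\<Sum>\<gamma><\<beta>. w \<gamma>) + t * w \<beta>\<close>.\<close>

lemma long_ray_order_chart:
  obtains h :: "long_ray \<Rightarrow> real" and W where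
    "strict_mono_on {..<ordinal_ray \<alpha>} h" "h ` {..<ordinal_ray \<alpha>} = {0..<W}"
proof -
  define w where "w \<gamma> = (1 / 2 :: real) ^ to_nat_on {..<\<alpha>} \<gamma>" for \<gamma>
  have w_pos: "w \<gamma> > 0" for \<gamma> by (simp add: w_def)
  have sm: "w summable_on {..<\<alpha>}"
    unfolding w_def by (rule summable_powers_countable[OF countable_lessThan_omega1])
  have sm_sub: "w summable_on A" if "A \<subseteq> {..<\<alpha>}" for A
    using summable_on_subset_banach[OF sm that] .
  define S where "S \<beta> = infsum w {..<\<beta>}" for \<beta>
  \<comment> \<open>The sum up to \<gamma> already contains the weight of \<beta>, so the intervals
    \<open>[S \<beta>, S \<beta> + w \<beta>)\<close> are disjoint and ordered like their
    indices.\<close>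
  have S_step: "S \<beta> + w \<beta> \<le> S \<gamma>" if "\<beta> < \<gamma>" "\<gamma> \<le> \<alpha>" for \<beta> \<gamma>
  proof -
    have "S \<beta> + w \<beta> = infsum w (insert \<beta> {..<\<beta>})"
      unfolding S_def using that by (subst infsum_insert) (auto intro!: sm_sub)
    also have "\<dots> \<le> S \<gamma>"
      unfolding S_def using that w_pos by (intro infsum_mono2 sm_sub) (auto intro: less_imp_le)
    finally show ?thesis .
  qed
  have S_nonneg: "S \<beta> \<ge> 0" for \<beta>
    unfolding S_def by (rule infsum_nonneg) (simp add: w_pos less_imp_le)
  \<comment> \<open>No gap arises at limit ordinals: a finite part of the sum exceeds
    \<open>v\<close>, and its largest index serves as \<gamma>.\<close>
  have S_approx: "\<exists>\<gamma><\<beta>. v < S \<gamma> + w \<gamma>" if "\<beta> \<le> \<alpha>" "0 \<le> v" "v < S \<beta>" for \<beta> v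
  proof -
    have "\<exists>F. finite F \<and> F \<subseteq> {..<\<beta>} \<and> v < sum w F"
    proof (rule ccontr)
      assume "\<not> ?thesis"
      then have "S \<beta> \<le> v"
        unfolding S_def using that by (intro infsum_le_finite_sums sm_sub) (auto simp: not_less)
      then show False using that by simp
    qed
    then obtain F where F: "finite F" "F \<subseteq> {..<\<beta>}" "v < sum w F" by blast
    then have ne: "F \<noteq> {}" using that by auto
    define \<gamma> where "\<gamma> = Max F"
    have \<gamma>: "\<gamma> \<in> F" "\<And>x. x \<in> F \<Longrightarrow> x \<le> \<gamma>" using F ne by (auto simp: \<gamma>_def)
    have "\<gamma> < \<beta>" using F \<gamma> by auto
    have "sum w F \<le> infsum w (insert \<gamma> {..<\<gamma>})"
      using F \<gamma> that \<open>\<gamma> < \<beta>\<close> w_pos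
      by (intro finite_sum_le_infsum sm_sub) (auto simp: less_le intro: less_imp_le)
    also have "\<dots> = S \<gamma> + w \<gamma>"
      unfolding S_def using that \<open>\<gamma> < \<beta>\<close> by (subst infsum_insert) (auto intro!: sm_sub)
    finally show ?thesis using F \<open>\<gamma> < \<beta>\<close> by auto
  qed
  define h where "h x = S (fst (Rep_long_ray x)) + snd (Rep_long_ray x) * w (fst (Rep_long_ray x))" for x
  have h_less: "h x < S (fst (Rep_long_ray x)) + w (fst (Rep_long_ray x))" for x
    using snd_Rep_long_ray[of x] w_pos[of "fst (Rep_long_ray x)"] by (simp add: h_def)
  have h_ge: "h x \<ge> S (fst (Rep_long_ray x))" for x
    using snd_Rep_long_ray[of x] w_pos[of "fst (Rep_long_ray x)"] by (simp add: h_def)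
  have mono: "h x < h y" if "y < ordinal_ray \<alpha>" "x < y" for x y
  proof (cases "fst (Rep_long_ray x) < fst (Rep_long_ray y)")
    case True
    then show ?thesis
      using S_step[OF True] that(1) h_less[of x] h_ge[of y]
      by (simp add: less_ordinal_ray_iff less_imp_le)
  next
    case False
    then show ?thesis using that w_pos by (simp add: less_long_ray_iff h_def)
  qed
  show thesis
  proof
    show "strict_mono_on {..<ordinal_ray \<alpha>} h" using mono by (auto simp: strict_mono_on_def)
    show "h ` {..<ordinal_ray \<alpha>} = {0..<S \<alpha>}"
    proof (intro equalityI subsetI)
      fix v assume "v \<in> h ` {..<ordinal_ray \<alpha>}"
      then obtain x where x: "fst (Rep_long_ray x) < \<alpha>" "v = h x"
        by (auto simp: less_ordinal_ray_iff)
      then show "v \<in> {0..<S \<alpha>}"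
        using h_less[of x] h_ge[of x] S_nonneg[of "fst (Rep_long_ray x)"] S_step[OF x(1)] by auto
    next
      fix v assume v: "v \<in> {0..<S \<alpha>}"
      \<comment> \<open>By leastness the interval of \<beta> cannot begin above \<open>v\<close>,
        since \<open>S_approx\<close> would then give a smaller index. Hence \<open>v\<close> lies
        in this interval, and its rescaled offset is the second coordinate of the preimage.\<close>
      define \<beta> where "\<beta> = (LEAST \<gamma>. v < S \<gamma> + w \<gamma>)"
      obtain \<gamma> where \<gamma>: "\<gamma> < \<alpha>" "v < S \<gamma> + w \<gamma>" using S_approx[of \<alpha> v] v by auto
      have \<beta>: "v < S \<beta> + w \<beta>" "\<beta> \<le> \<gamma>"
        unfolding \<beta>_def using \<gamma>(2) by (auto intro: LeastI Least_le)
      have "S \<beta> \<le> v"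
      proof (rule ccontr)
        assume "\<not> S \<beta> \<le> v"
        moreover have "\<beta> \<le> \<alpha>" using \<beta> \<gamma> by (meson le_less_trans less_imp_le)
        ultimately obtain \<delta> where "\<delta> < \<beta>" "v < S \<delta> + w \<delta>"
          using S_approx[of \<beta> v] v by auto
        then show False unfolding \<beta>_def using not_less_Least by blast
      qed
      define x where "x = Abs_long_ray (\<beta>, (v - S \<beta>) / w \<beta>)"
      have "Rep_long_ray x = (\<beta>, (v - S \<beta>) / w \<beta>)"
        unfolding x_def using \<open>S \<beta> \<le> v\<close> \<beta> w_pos[of \<beta>]
        by (intro Abs_long_ray_inverse) (auto simp: field_simps)
      then have "h x = v" "x < ordinal_ray \<alpha>"
        using w_pos[of \<beta>] \<beta> \<gamma> by (auto simp: h_def less_ordinal_ray_iff)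
      then show "v \<in> h ` {..<ordinal_ray \<alpha>}" by auto
    qed
  qed
qed

text \<open>A bound for \<open>f x\<close> in the order-convex image is the value at a point of
  \<open>A\<close>, which then bounds \<open>x\<close>; a bound beyond the image on its side holds
  for all values. Applied to an order isomorphism and to its inverse, this gives a
  homeomorphism.\<close>

lemma continuous_on_strict_mono_onto_interval:
  fixes f :: "'a::linorder_topology \<Rightarrow> 'b::linorder_topology"
  assumes mono: "strict_mono_on A f" and onto: "f ` A = B"
    and B: "\<And>b c d. b \<in> B \<Longrightarrow> d \<in> B \<Longrightarrow> b \<le> c \<Longrightarrow> c \<le> d \<Longrightarrow> c \<in> B"
  shows "continuous_on A f"
  unfolding continuous_on_def
proof (intro ballI order_tendstoI)
  fix x c assume x: "x \<in> A" and c: "c < f x"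
  show "eventually (\<lambda>y. c < f y) (at x within A)"
  proof (cases "\<exists>b\<in>B. b \<le> c")
    case True
    then have "c \<in> B" using B[of _ "f x" c] x c onto by (auto intro: less_imp_le)
    then obtain a where a: "a \<in> A" "c = f a" using onto by auto
    then have "a < x" using c mono x strict_mono_on_less by blast
    then have "eventually (\<lambda>y. a < y) (at x within A)"
      by (rule order_tendstoD(1)[OF tendsto_ident_at])
    then show ?thesis
      using a mono
      by (auto simp: eventually_at_filter strict_mono_on_def elim!: eventually_mono)
  next
    case False
    then show ?thesis using onto by (auto simp: eventually_at_filter not_le)
  qed
next
  fix x c assume x: "x \<in> A" and c: "f x < c"
  show "eventually (\<lambda>y. f y < c) (at x within A)"
  proof (cases "\<exists>b\<in>B. c \<le> b")
    case True
    then have "c \<in> B" using B[of "f x" _ c] x c onto by (auto intro: less_imp_le)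
    then obtain a where a: "a \<in> A" "c = f a" using onto by auto
    then have "x < a" using c mono x strict_mono_on_less by blast
    then have "eventually (\<lambda>y. y < a) (at x within A)"
      by (rule order_tendstoD(2)[OF tendsto_ident_at])
    then show ?thesis
      using a mono
      by (auto simp: eventually_at_filter strict_mono_on_def elim!: eventually_mono)
  next
    case False
    then show ?thesis using onto by (auto simp: eventually_at_filter not_le)
  qed
qed

text \<open>An order homeomorphism \<open>h\<close> onto \<open>[0, W)\<close>, bundled with its
  inverse \<open>g\<close>. If \<alpha> is the least ordinal, the initial segment is empty and
  \<open>W\<close> is not positive.\<close>

definition ray_chart :: "omega1 \<Rightarrow> (long_ray \<Rightarrow> real) \<Rightarrow> (real \<Rightarrow> long_ray) \<Rightarrow> real \<Rightarrow> bool" where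
  "ray_chart \<alpha> h g W \<longleftrightarrow>
     (\<forall>x<ordinal_ray \<alpha>. \<forall>y<ordinal_ray \<alpha>. h x < h y \<longleftrightarrow> x < y) \<and>
     (\<forall>x<ordinal_ray \<alpha>. 0 \<le> h x \<and> h x < W \<and> g (h x) = x) \<and>
     (\<forall>t\<in>{0..<W}. g t < ordinal_ray \<alpha> \<and> h (g t) = t) \<and>
     continuous_on {..<ordinal_ray \<alpha>} h \<and> continuous_on {0..<W} g"

lemma ray_chart_exists: obtains h g W where "ray_chart \<alpha> h g W"
proof -
  let ?A = "{..<ordinal_ray \<alpha>}"
  obtain h :: "long_ray \<Rightarrow> real" and W where h: "strict_mono_on ?A h" "h ` ?A = {0..<W}"
    by (rule long_ray_order_chart)
  have inj: "inj_on h ?A" using h(1) by (rule strict_mono_on_imp_inj_on)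
  let ?g = "inv_into ?A h"
  have less: "h x < h y \<longleftrightarrow> x < y" if "x \<in> ?A" "y \<in> ?A" for x y
    using strict_mono_on_less[OF h(1) that] .
  have g: "?g t \<in> ?A" "h (?g t) = t" if "t \<in> {0..<W}" for t
    using that h(2) by (metis inv_into_into, metis f_inv_into_f)
  have "ray_chart \<alpha> h ?g W"
    unfolding ray_chart_def
  proof (intro conjI)
    show "continuous_on ?A h"
      by (rule continuous_on_strict_mono_onto_interval[OF h]) auto
    show "continuous_on {0..<W} ?g"
    proof (rule continuous_on_strict_mono_onto_interval)
      show "strict_mono_on {0..<W} ?g"
        by (intro strict_mono_onI) (metis g less)
      show "?g ` {0..<W} = ?A" using inv_into_image_cancel[OF inj order_refl] h(2) by metis
    qed auto
  qed (use h(2) inj g less in \<open>auto\<close>)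
  then show thesis by (rule that)
qed

section \<open>Order and convergence in the long ray\<close>

lemma ordinal_ray_less_iff: "ordinal_ray \<alpha> < ordinal_ray \<beta> \<longleftrightarrow> \<alpha> < \<beta>"
  by (simp add: less_ordinal_ray_iff Rep_ordinal_ray)

lemma greater_omega1: "\<exists>\<beta>::omega1. \<alpha> < \<beta>"
  using countable_bounded_omega1[of "{\<alpha>}"] by auto

lemma countable_bounded_long_ray:
  assumes "countable A"
  obtains \<alpha> where "\<And>x. x \<in> A \<Longrightarrow> x < ordinal_ray \<alpha>"
proof -
  obtain \<alpha> where "\<And>\<gamma>. \<gamma> \<in> (fst \<circ> Rep_long_ray) ` A \<Longrightarrow> \<gamma> < \<alpha>"
    using countable_bounded_omega1 countable_image[OF assms] by metis
  then show thesis using that[of \<alpha>] by (simp add: less_ordinal_ray_iff)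
qed

lemma bounded_long_ray_iff: "bounded_long_ray A \<longleftrightarrow> (\<exists>b. \<forall>x\<in>A. x \<le> b)"
proof
  assume "\<exists>b. \<forall>x\<in>A. x \<le> b"
  then obtain b where b: "\<forall>x\<in>A. x \<le> b" by blast
  obtain \<alpha> where "b < ordinal_ray \<alpha>" using countable_bounded_long_ray[of "{b}"] by auto
  with b show "bounded_long_ray A"
    by (auto simp: bounded_long_ray_def intro!: exI[of _ \<alpha>] intro: le_less_trans)
qed (auto simp: bounded_long_ray_def intro: less_imp_le)

lemma greater_long_ray: "\<exists>y::long_ray. x < y"
  using countable_bounded_long_ray[of "{x}"] by auto

definition ray0 :: long_ray where
  "ray0 = ordinal_ray (LEAST \<alpha>. True)"

lemma ray0_le: "ray0 \<le> x"
  using snd_Rep_long_ray[of x] Least_le[of "\<lambda>_. True" "fst (Rep_long_ray x)"]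
  by (auto simp: ray0_def less_eq_long_ray_def Rep_ordinal_ray)

lemma ray_chart_ray0:
  assumes "ray_chart \<alpha> h g W" "x < ordinal_ray \<alpha>"
  shows "h ray0 = 0" "g 0 = ray0"
proof -
  have x: "ray0 < ordinal_ray \<alpha>" using ray0_le[of x] assms(2) by simp
  then have "0 \<le> h ray0" "0 \<in> {0..<W}" using assms(1) by (auto simp: ray_chart_def)
  moreover have "\<not> h (g 0) < h ray0"
    using assms(1) x \<open>0 \<in> {0..<W}\<close> ray0_le[of "g 0"] unfolding ray_chart_def by (metis not_less)
  ultimately show "h ray0 = 0" using assms(1) by (auto simp: ray_chart_def)
  then show "g 0 = ray0" using assms(1) x by (auto simp: ray_chart_def)
qed

text \<open>A countable set is bounded, so the whole sequence lies in one chart, where bounded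
  monotone real sequences converge.\<close>

lemma incseq_long_ray_converges:
  fixes X :: "nat \<Rightarrow> long_ray"
  assumes "incseq X"
  obtains s where "X \<longlonglongrightarrow> s" "\<And>k. X k \<le> s"
proof -
  obtain \<beta> where \<beta>: "\<And>k. X k < ordinal_ray \<beta>"
    using countable_bounded_long_ray[of "range X"] by (metis countableI_type countable_image rangeI)
  \<comment> \<open>The larger ordinal leaves room above \<beta>: the real limit is at most
    \<open>h (ordinal_ray \<beta>)\<close> and so stays inside the half-open range of the
    chart.\<close>
  obtain \<alpha> where \<alpha>: "\<beta> < \<alpha>" using greater_omega1 by blast
  obtain h g W where c: "ray_chart \<alpha> h g W" by (rule ray_chart_exists)
  have b: "ordinal_ray \<beta> < ordinal_ray \<alpha>" using \<alpha> by (simp add: ordinal_ray_less_iff)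
  then have X: "X k < ordinal_ray \<alpha>" for k using \<beta> less_trans by blast
  have hX: "0 \<le> h (X k)" "h (X k) < h (ordinal_ray \<beta>)" "g (h (X k)) = X k" for k
    using c X b \<beta> by (auto simp: ray_chart_def)
  have W: "h (ordinal_ray \<beta>) < W" using c b by (auto simp: ray_chart_def)
  have inc: "incseq (\<lambda>k. h (X k))"
    using assms c X unfolding ray_chart_def incseq_def by (meson not_less)
  obtain t where t: "(\<lambda>k. h (X k)) \<longlonglongrightarrow> t" "\<And>k. h (X k) \<le> t"
    using incseq_convergent[OF inc, of "h (ordinal_ray \<beta>)"] hX(2) less_imp_le by metis
  have "t \<le> h (ordinal_ray \<beta>)" using t(1) hX(2) less_imp_le by (metis LIMSEQ_le_const2)
  moreover have "0 \<le> t" using hX(1)[of 0] t(2)[of 0] by simp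
  ultimately have tW: "t \<in> {0..<W}" using W by simp
  have "continuous_on {0..<W} g" using c by (simp add: ray_chart_def)
  then have "(\<lambda>k. g (h (X k))) \<longlonglongrightarrow> g t"
    by (rule continuous_on_tendsto_compose[OF _ t(1) tW]) (use hX W in \<open>auto intro: less_trans always_eventually\<close>)
  then have "X \<longlonglongrightarrow> g t" by (simp add: hX(3))
  then show thesis using incseq_le[OF assms] that by blast
qed

section \<open>The surface\<close>

text \<open>For each integer \<open>n\<close> the triples \<open>(n, x, y)\<close> with \<open>y < x\<close> form an octant without its diagonal;
  the diagonal of the octant \<open>n\<close> is the ray \<open>(n + 1, x, ray0)\<close>. The topology is the one making the
  level \<open>x\<close> and, for every \<open>k\<close>, the height within the octant \<open>k\<close> (truncated to
  \<open>[ray0, x]\<close>) continuous.\<close>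

definition coords :: "int \<times> long_ray \<times> long_ray \<Rightarrow> long_ray \<times> (int \<Rightarrow> long_ray)" where
  "coords = (\<lambda>(n, x, y). (x, \<lambda>k. if k < n then x else if k = n then y else ray0))"

definition octants :: "(int \<times> long_ray \<times> long_ray) topology" where
  "octants = pullback_topology {(n, x, y). y < x} coords euclidean"

text \<open>Parametrises the octant together with its diagonal. The second branch is meant for
  \<open>y = x\<close>; there the point belongs to the space only if \<open>ray0 < x\<close>, which
  is the omission of the corner.\<close>

definition oct :: "int \<Rightarrow> long_ray \<Rightarrow> long_ray \<Rightarrow> int \<times> long_ray \<times> long_ray" where
  "oct n x y = (if y < x then (n, x, y) else (n + 1, x, ray0))"

definition below :: "omega1 \<Rightarrow> (int \<times> long_ray \<times> long_ray) set" where
  "below \<alpha> = {(n, x, y). y < x \<and> x < ordinal_ray \<alpha>}"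

lemma topspace_octants: "topspace octants = {(n, x, y). y < x}"
  by (simp add: octants_def topspace_pullback_topology)

text \<open>The gluing is invisible in coordinates: for \<open>y = x\<close> both descriptions give
  height \<open>x\<close> in the octant \<open>n\<close> and \<open>ray0\<close> in the octant
  \<open>n + 1\<close>. Hence \<open>oct n\<close> is continuous up to the diagonal.\<close>

lemma coords_oct: "y \<le> x \<Longrightarrow> coords (oct n x y) = (x, \<lambda>k. if k < n then x else if k = n then y else ray0)"
  by (auto simp: coords_def oct_def fun_eq_iff)

lemma continuous_map_coords: "continuous_map octants euclidean coords"
  unfolding octants_def
  using continuous_map_pullback[of euclidean euclidean id "{(n, x, y). y < x}" coords] by simp

lemma continuous_map_level: "continuous_map octants euclidean (\<lambda>p. fst (coords p))"
  using continuous_map_compose[OF continuous_map_coords, of euclidean fst]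
  by (simp add: comp_def continuous_on_fst)

lemma continuous_map_height: "continuous_map octants euclidean (\<lambda>p. snd (coords p) k)"
proof -
  have "continuous_on UNIV (\<lambda>q::long_ray \<times> (int \<Rightarrow> long_ray). snd q k)"
    by (intro continuous_on_compose2[OF continuous_on_product_coordinates continuous_on_snd]
        continuous_on_id) simp
  then show ?thesis
    using continuous_map_compose[OF continuous_map_coords, of euclidean "\<lambda>q. snd q k"]
    by (simp add: comp_def)
qed

lemma continuous_map_into_octants:
  assumes "f \<in> T \<rightarrow> topspace octants" "continuous_on T (\<lambda>t. fst (coords (f t)))"
    "\<And>k. continuous_on T (\<lambda>t. snd (coords (f t)) k)"
  shows "continuous_map (top_of_set T) octants f"
  unfolding octants_def
proof (rule continuous_map_pullback')
  have "continuous_on T (\<lambda>t. snd (coords (f t)))"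
    using assms(3) by (intro continuous_on_coordinatewise_then_product)
  then have "continuous_on T (\<lambda>t. (fst (coords (f t)), snd (coords (f t))))"
    using assms(2) by (intro continuous_on_Pair)
  then show "continuous_map (top_of_set T) euclidean (coords \<circ> f)"
    by (simp add: comp_def)
  show "topspace (top_of_set T) \<subseteq> f -` {(n, x, y). y < x}"
    using assms(1) by (fastforce simp: topspace_octants)
qed

lemma continuous_map_oct:
  "continuous_map (top_of_set {(x, y). y \<le> x \<and> ray0 < x}) octants (\<lambda>(x, y). oct n x y)"
proof (rule continuous_map_into_octants)
  let ?T = "{(x, y). y \<le> x \<and> ray0 < x}"
  show "(\<lambda>(x, y). oct n x y) \<in> ?T \<rightarrow> topspace octants"
    by (auto simp: topspace_octants oct_def split: if_splits)
  show "continuous_on ?T (\<lambda>t. fst (coords (case t of (x, y) \<Rightarrow> oct n x y)))"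
    by (rule continuous_on_eq[where f=fst]) (auto simp: coords_oct continuous_on_fst)
  fix k
  have "continuous_on ?T (\<lambda>t. if k < n then fst t else if k = n then snd t else ray0)"
    by (cases "k < n"; cases "k = n") (simp_all add: continuous_on_fst continuous_on_snd)
  then show "continuous_on ?T (\<lambda>t. snd (coords (case t of (x, y) \<Rightarrow> oct n x y)) k)"
    by (rule continuous_on_eq) (auto simp: coords_oct)
qed

section \<open>Planar charts of the bounded parts\<close>

lemma openin_below: "openin octants (below \<alpha>)"
proof -
  have "below \<alpha> = {p \<in> topspace octants. fst (coords p) \<in> {..<ordinal_ray \<alpha>}}"
    by (auto simp: below_def topspace_octants coords_def)
  then show ?thesis
    using openin_continuous_map_preimage[OF continuous_map_level, of "{..<ordinal_ray \<alpha>}"] by simp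
qed

text \<open>With \<open>u = h x\<close> and \<open>z = n * u + h y\<close>, the octant
  \<open>n\<close> becomes the sector \<open>n * u \<le> z < (n + 1) * u\<close> of the strip. The
  integer is recovered as the floor of \<open>z / u\<close>, the height from the remainder.\<close>

lemma homeomorphic_below:
  assumes c: "ray_chart \<alpha> h g W"
  shows "subtopology octants (below \<alpha>) homeomorphic_space
    top_of_set ((UNIV :: real set) \<times> {0<..<W})"
proof -
  let ?B = "(UNIV :: real set) \<times> {0<..<W}"
  define \<phi> where "\<phi> = (\<lambda>(n, x, y). (of_int n * h x + h y, h x))"
  define \<psi> where "\<psi> = (\<lambda>(z, u). (\<lfloor>z / u\<rfloor>, g u, g (z - of_int \<lfloor>z / u\<rfloor> * u)))"
  have hg: "h x < h y \<longleftrightarrow> x < y" "0 \<le> h x" "h x < W" "g (h x) = x"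
    if "x < ordinal_ray \<alpha>" "y < ordinal_ray \<alpha>" for x y
    using c that by (auto simp: ray_chart_def)
  have gh: "g t < ordinal_ray \<alpha>" "h (g t) = t" if "0 \<le> t" "t < W" for t
    using c that by (auto simp: ray_chart_def)
  have top: "topspace (subtopology octants (below \<alpha>)) = below \<alpha>"
    by (auto simp: topspace_octants below_def)
  have \<phi>: "\<phi> p \<in> ?B \<and> \<psi> (\<phi> p) = p" if p: "p \<in> below \<alpha>" for p
  proof -
    obtain n x y where p: "p = (n, x, y)" "y < x" "x < ordinal_ray \<alpha>" "y < ordinal_ray \<alpha>"
      using p by (auto simp: below_def)
    have "0 \<le> h y" "h y < h x" "h x < W" using hg p by auto
    then have "0 < h x" by linarith
    then have fl: "\<lfloor>(of_int n * h x + h y) / h x\<rfloor> = n"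
      using \<open>0 \<le> h y\<close> \<open>h y < h x\<close> by (intro floor_unique) (auto simp: field_simps)
    show ?thesis using p hg fl \<open>0 < h x\<close> by (auto simp: \<phi>_def \<psi>_def)
  qed
  have frac: "0 \<le> z - of_int \<lfloor>z / u\<rfloor> * u" "z - of_int \<lfloor>z / u\<rfloor> * u < u" if "0 < u" for z u :: real
    using floor_divide_lower[OF that, of z] floor_divide_upper[OF that, of z]
    by (simp_all add: algebra_simps)
  have \<psi>: "\<psi> q \<in> below \<alpha> \<and> \<phi> (\<psi> q) = q" if q: "q \<in> ?B" for q
  proof -
    obtain z u where q: "q = (z, u)" "0 < u" "u < W" using q by auto
    let ?v = "z - of_int \<lfloor>z / u\<rfloor> * u"
    have "h (g ?v) = ?v" "g ?v < ordinal_ray \<alpha>" "h (g u) = u" "g u < ordinal_ray \<alpha>"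
      using gh frac[OF q(2), of z] q by auto
    then show ?thesis
      using q frac[OF q(2), of z] hg(1)[of "g ?v" "g u"]
      by (auto simp: \<phi>_def \<psi>_def below_def)
  qed
  have "continuous_map (subtopology octants (below \<alpha>)) euclidean \<phi>"
  proof (rule pasting_lemma[where I=UNIV])
    \<comment> \<open>The open piece \<open>?T i\<close> meets only the octants \<open>i - 1\<close>
      and \<open>i\<close>. The single expression \<open>?f i\<close> describes the map on both, so
      continuity across their common edge needs no case distinction.\<close>
    let ?T = "\<lambda>i. {p \<in> topspace octants. ray0 < snd (coords p) (i - 1)} \<inter>
      {p \<in> topspace octants. snd (coords p) i < fst (coords p)} \<inter> below \<alpha>"
    let ?f = "\<lambda>i p. (of_int (i - 1) * h (fst (coords p)) + h (snd (coords p) (i - 1))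
      + h (snd (coords p) i), h (fst (coords p)))"
    have f: "?f i p = \<phi> p" if Ti: "p \<in> ?T i" for i p
    proof -
      obtain n x y where p: "p = (n, x, y)" "y < x" "x < ordinal_ray \<alpha>"
        using Ti by (auto simp: below_def)
      have "i = n \<or> i = n + 1" using Ti p by (auto simp: coords_def split: if_splits)
      then show ?thesis
        using p ray_chart_ray0[OF c p(3)] by (auto simp: coords_def \<phi>_def algebra_simps)
    qed
    show "?f i p = ?f j p"
      if "p \<in> topspace (subtopology octants (below \<alpha>)) \<inter> ?T i \<inter> ?T j" for i j p
      using f that by simp
    show "\<exists>j. j \<in> UNIV \<and> p \<in> ?T j \<and> \<phi> p = ?f j p"
      if tp: "p \<in> topspace (subtopology octants (below \<alpha>))" for p
    proof -
      obtain n x y where p: "p = (n, x, y)" "y < x" "x < ordinal_ray \<alpha>"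
        using tp unfolding top by (auto simp: below_def)
      have "p \<in> ?T n"
        using p ray0_le[of y] by (auto simp: topspace_octants below_def coords_def)
      then show ?thesis using f[of p n] by (intro exI[of _ n] conjI UNIV_I) simp_all
    qed
    show "openin (subtopology octants (below \<alpha>)) (?T i)" for i
    proof -
      have "openin octants {p \<in> topspace octants. snd (coords p) (i - 1) \<in> {ray0<..}}"
        by (rule openin_continuous_map_preimage[OF continuous_map_height]) simp
      moreover have "openin octants {p \<in> topspace octants. snd (coords p) i < fst (coords p)}"
      proof -
        have "open {q :: long_ray \<times> (int \<Rightarrow> long_ray). snd q i < fst q}"
          by (intro open_Collect_less continuous_on_fst continuous_on_id
              continuous_on_compose2[OF continuous_on_product_coordinates continuous_on_snd]) simp
        then show ?thesis
          using openin_continuous_map_preimage[OF continuous_map_coords] by fastforce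
      qed
      ultimately show ?thesis by (auto simp: openin_subtopology)
    qed
    show "continuous_map (subtopology (subtopology octants (below \<alpha>)) (?T i)) euclidean (?f i)" for i
    proof -
      let ?Q = "{q :: long_ray \<times> (int \<Rightarrow> long_ray). fst q < ordinal_ray \<alpha> \<and> (\<forall>k. snd q k < ordinal_ray \<alpha>)}"
      have h: "continuous_on {..<ordinal_ray \<alpha>} h" using c by (simp add: ray_chart_def)
      have h1: "continuous_on ?Q (\<lambda>q. h (fst q))"
        by (rule continuous_on_compose2[OF h continuous_on_fst[OF continuous_on_id]]) auto
      have h2: "continuous_on ?Q (\<lambda>q. h (snd q k))" for k
        by (rule continuous_on_compose2[OF h])
          (auto intro: continuous_on_compose2[OF continuous_on_product_coordinates
              continuous_on_snd[OF continuous_on_id]])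
      have "continuous_on ?Q (\<lambda>q. (of_int (i - 1) * h (fst q) + h (snd q (i - 1))
          + h (snd q i), h (fst q)))"
        by (intro continuous_intros h1 h2)
      moreover have "continuous_map (subtopology (subtopology octants (below \<alpha>)) (?T i))
          (top_of_set ?Q) coords"
        by (intro continuous_map_into_subtopology continuous_map_from_subtopology
            continuous_map_coords)
          (auto simp: below_def coords_def intro: less_trans le_less_trans[OF ray0_le])
      ultimately show ?thesis
        using continuous_map_compose[of _ "top_of_set ?Q" coords euclidean]
        by (fastforce simp: comp_def)
    qed
  qed
  then have 1: "continuous_map (subtopology octants (below \<alpha>)) (top_of_set ?B) \<phi>"
    using \<phi> by (intro continuous_map_into_subtopology) (auto simp: top)
  have "continuous_map (top_of_set ?B) octants \<psi>"
  proof (rule continuous_map_into_octants)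
    have g: "continuous_on {0..<W} g" using c by (simp add: ray_chart_def)
    show "\<psi> \<in> ?B \<rightarrow> topspace octants"
      using \<psi> by (fastforce simp: topspace_octants below_def)
    have "continuous_on ?B (\<lambda>q. g (snd q))"
      by (rule continuous_on_compose2[OF g]) (auto intro: continuous_intros)
    then show "continuous_on ?B (\<lambda>q. fst (coords (\<psi> q)))"
      by (rule continuous_on_eq) (auto simp: \<psi>_def coords_def)
    fix k
    \<comment> \<open>The height within the octant \<open>k\<close> comes from
      \<open>z - k * u\<close> clamped to \<open>[0, u]\<close>: the clamp gives \<open>u\<close>
      for earlier octants, 0 for later ones and the remainder for the current one. This replaces the
      discontinuous floor by a continuous expression.\<close>
    have "continuous_on ?B (\<lambda>q. g (max 0 (min (snd q) (fst q - of_int k * snd q))))"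
      by (rule continuous_on_compose2[OF g]) (auto intro!: continuous_intros)
    then show "continuous_on ?B (\<lambda>q. snd (coords (\<psi> q)) k)"
    proof (rule continuous_on_eq)
      fix q assume "q \<in> ?B"
      then obtain z u where q: "q = (z, u)" "0 < u" "u < W" by auto
      let ?n = "\<lfloor>z / u\<rfloor>"
      have g0: "g 0 = ray0"
        using ray_chart_ray0(2)[OF c gh(1), of 0] q by simp
      note fr = frac[OF q(2), of z]
      consider "k < ?n" | "k = ?n" | "k > ?n" by linarith
      then show "g (max 0 (min (snd q) (fst q - of_int k * snd q))) = snd (coords (\<psi> q)) k"
      proof cases
        case 1
        then have "of_int (k + 1) * u \<le> of_int ?n * u" using q by (intro mult_right_mono) auto
        then have "u \<le> z - of_int k * u" using fr by (simp add: algebra_simps)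
        then show ?thesis using 1 q by (simp add: \<psi>_def coords_def)
      next
        case 2
        then show ?thesis using q fr by (simp add: \<psi>_def coords_def)
      next
        case 3
        then have "of_int (?n + 1) * u \<le> of_int k * u" using q by (intro mult_right_mono) auto
        then have "z - of_int k * u \<le> 0" using fr by (simp add: algebra_simps)
        then show ?thesis using 3 q g0 by (simp add: \<psi>_def coords_def)
      qed
    qed
  qed
  then have "continuous_map (top_of_set ?B) (subtopology octants (below \<alpha>)) \<psi>"
    using \<psi> by (intro continuous_map_into_subtopology) auto
  with 1 \<phi> \<psi> show ?thesis
    unfolding homeomorphic_space_def homeomorphic_maps_def top topspace_euclidean_subtopology
    by blast
qed

section \<open>The surface is of Type I\<close>

lemma below_mono: "\<alpha> \<le> \<beta> \<Longrightarrow> below \<alpha> \<subseteq> below \<beta>"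
  using ordinal_ray_less_iff[of \<alpha> \<beta>] by (auto simp: below_def le_less intro: less_trans)

lemma below_cover: "topspace octants = (\<Union>\<alpha>. below \<alpha>)"
proof -
  have "\<exists>\<alpha>. x < ordinal_ray \<alpha>" for x
    using countable_bounded_long_ray[of "{x}"] by auto
  then show ?thesis by (auto simp: topspace_octants below_def)
qed

lemma Hausdorff_octants: "Hausdorff_space octants"
  unfolding Hausdorff_space_def
proof (intro allI impI)
  fix p q assume pq: "p \<in> topspace octants \<and> q \<in> topspace octants \<and> p \<noteq> q"
  have "\<exists>f :: _ \<Rightarrow> long_ray. continuous_map octants euclidean f \<and> f p \<noteq> f q"
  proof (rule ccontr)
    assume "\<not> ?thesis"
    then have coords_eq: "fst (coords p) = fst (coords q)"
        "\<And>k. snd (coords p) k = snd (coords q) k"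
      using continuous_map_level continuous_map_height by blast+
    obtain n x y m x' y' where e: "p = (n, x, y)" "q = (m, x', y')" by (metis prod_cases3)
    have k: "x = x'" using coords_eq(1) e by (simp add: coords_def)
    have k': "(if k < n then x else if k = n then y else ray0) =
        (if k < m then x' else if k = m then y' else ray0)" for k
      using coords_eq(2)[of k] e by (simp add: coords_def split del: if_split)
    have "y < x" "y' < x" using pq e k by (auto simp: topspace_octants)
    \<comment> \<open>If \<open>n\<close> and \<open>m\<close> differed, the height at the smaller
      index would be the full level for one point but strictly less for the other.\<close>
    with k'[of n] k'[of m] k ray0_le have "n = m \<and> y = y'" by (auto split: if_splits)
    with k pq e show False by simp
  qed
  then obtain f :: "_ \<Rightarrow> long_ray" where f: "continuous_map octants euclidean f" "f p \<noteq> f q" by blast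
  obtain U V where UV: "open U" "open V" "f p \<in> U" "f q \<in> V" "U \<inter> V = {}"
    using hausdorff[OF f(2)] by blast
  have "openin octants {z \<in> topspace octants. f z \<in> U}" "openin octants {z \<in> topspace octants. f z \<in> V}"
    using UV openin_continuous_map_preimage[OF f(1)] by auto
  then show "\<exists>U V. openin octants U \<and> openin octants V \<and> p \<in> U \<and> q \<in> V \<and> disjnt U V"
    using UV(3-5) pq
    by (intro exI[of _ "{z \<in> topspace octants. f z \<in> U}"]
        exI[of _ "{z \<in> topspace octants. f z \<in> V}"] conjI) (auto simp: disjnt_def)
qed

lemma Lindelof_below: "Lindelof_space (subtopology octants (below \<alpha>))"
proof -
  obtain h g W where c: "ray_chart \<alpha> h g W" by (rule ray_chart_exists)
  let ?B = "(UNIV :: real set) \<times> {0<..<W}"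
  have "Lindelof_space (top_of_set ?B)"
    unfolding Lindelof_space_def by (metis Lindelof_openin)
  moreover obtain f where "homeomorphic_map (top_of_set ?B) (subtopology octants (below \<alpha>)) f"
    using homeomorphic_below[OF c] homeomorphic_space homeomorphic_space_sym by metis
  ultimately show ?thesis
    using Lindelof_space_continuous_map_image homeomorphic_imp_continuous_map
      homeomorphic_imp_surjective_map by metis
qed

lemma connected_octants: "connected_space octants"
proof -
  have conn: "connectedin octants (below \<alpha>)" for \<alpha>
  proof -
    obtain h g W where c: "ray_chart \<alpha> h g W" by (rule ray_chart_exists)
    have "connected ((UNIV :: real set) \<times> {0<..<W})"
      by (intro convex_connected convex_Times) auto
    then have "connectedin euclidean ((UNIV :: real set) \<times> {0<..<W})" by simp
    then have "connected_space (subtopology octants (below \<alpha>))"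
      using homeomorphic_connected_space[OF homeomorphic_below[OF c]] unfolding connectedin_def
      by blast
    then show ?thesis
      using openin_subset[OF openin_below] by (simp add: connectedin_def)
  qed
  obtain x where x: "ray0 < x" using greater_long_ray by blast
  obtain \<alpha> where \<alpha>: "x < ordinal_ray \<alpha>" using countable_bounded_long_ray[of "{x}"] by auto
  have p: "(0, x, ray0) \<in> below \<alpha>" using x \<alpha> by (simp add: below_def)
  \<comment> \<open>Only indices from \<alpha> on are used, so that all the strips share the chosen
    point.\<close>
  have "connectedin octants (\<Union> (below ` {\<alpha>..}))"
  proof (rule connectedin_Union)
    have "(0, x, ray0) \<in> \<Inter> (below ` {\<alpha>..})" using p below_mono by blast
    then show "\<Inter> (below ` {\<alpha>..}) \<noteq> {}" by blast
  qed (use conn in auto)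
  moreover have "\<Union> (below ` {\<alpha>..}) = topspace octants"
  proof -
    have "below \<beta> \<subseteq> \<Union> (below ` {\<alpha>..})" for \<beta>
      using below_mono[of \<beta> "max \<alpha> \<beta>"] by fastforce
    then show ?thesis unfolding below_cover by blast
  qed
  ultimately show ?thesis by (simp add: connectedin_topspace)
qed

text \<open>Every point has a chart onto an open strip inside the open half-plane, so no boundary
  points occur.\<close>

lemma surface_octants: "surface octants"
  unfolding surface_def
proof (intro conjI Hausdorff_octants connected_octants ballI)
  fix p assume "p \<in> topspace octants"
  then obtain \<alpha> where p: "p \<in> below \<alpha>" using below_cover by blast
  obtain h g W where c: "ray_chart \<alpha> h g W" by (rule ray_chart_exists)
  let ?B = "(UNIV :: real set) \<times> {0<..<W}"
  have "open ?B" by (intro open_Times) auto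
  then have "openin (top_of_set {p. snd p \<ge> 0}) ?B"
    by (auto simp: openin_open intro!: exI[of _ ?B])
  then show "\<exists>U V. openin octants U \<and> p \<in> U \<and>
      openin (top_of_set {p :: real \<times> real. 0 \<le> snd p}) V \<and>
      subtopology octants U homeomorphic_space top_of_set V"
    using p openin_below homeomorphic_below[OF c] by blast
qed

text \<open>Preimages of initial segments form an open cover; a countable subcover involves
  countably many ordinals, which have a common bound.\<close>

lemma Lindelof_imp_bounded_image:
  fixes f :: "'a \<Rightarrow> long_ray"
  assumes "Lindelof_space X" "continuous_map X euclidean f"
  obtains b where "\<And>p. p \<in> topspace X \<Longrightarrow> f p < b"
proof -
  define U where "U \<gamma> = {p \<in> topspace X. f p \<in> {..<ordinal_ray \<gamma>}}" for \<gamma>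
  have "openin X (U \<gamma>)" for \<gamma>
    unfolding U_def by (rule openin_continuous_map_preimage[OF assms(2)]) simp
  then have "openin X V" if "V \<in> range U" for V
    using that by blast
  moreover have "\<Union> (range U) = topspace X"
  proof -
    have "\<exists>\<gamma>. f p < ordinal_ray \<gamma>" for p
      using countable_bounded_long_ray[of "{f p}"] by auto
    then show ?thesis by (auto simp: U_def)
  qed
  ultimately obtain \<V> where \<V>: "countable \<V>" "\<V> \<subseteq> range U" "\<Union>\<V> = topspace X"
    using assms(1) unfolding Lindelof_space_def by meson
  then obtain I where I: "countable I" "\<V> = U ` I" by (metis countable_subset_image)
  obtain \<beta> where \<beta>: "\<And>\<gamma>. \<gamma> \<in> I \<Longrightarrow> \<gamma> < \<beta>" using countable_bounded_omega1[OF I(1)] by blast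
  show thesis
  proof (rule that)
    fix p assume "p \<in> topspace X"
    then obtain \<gamma> where \<gamma>: "\<gamma> \<in> I" "p \<in> U \<gamma>" using I(2) \<V>(3) by blast
    then have "f p < ordinal_ray \<gamma>" by (simp add: U_def)
    also have "\<dots> < ordinal_ray \<beta>" using \<beta>[OF \<gamma>(1)] by (simp add: ordinal_ray_less_iff)
    finally show "f p < ordinal_ray \<beta>" .
  qed
qed

lemma closure_below_subset:
  "octants closure_of below \<alpha> \<subseteq> {p \<in> topspace octants. fst (coords p) \<in> {..ordinal_ray \<alpha>}}"
proof (rule closure_of_minimal)
  show "below \<alpha> \<subseteq> {p \<in> topspace octants. fst (coords p) \<in> {..ordinal_ray \<alpha>}}"
    by (auto simp: below_def topspace_octants coords_def)
  show "closedin octants {p \<in> topspace octants. fst (coords p) \<in> {..ordinal_ray \<alpha>}}"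
    by (rule closedin_continuous_map_preimage[OF continuous_map_level]) simp
qed

lemma typeI_cover_below: "typeI_cover octants below"
proof -
  have cl: "octants closure_of below \<alpha> \<subseteq> below \<beta>" if "\<alpha> < \<beta>" for \<alpha> \<beta>
    using closure_below_subset[of \<alpha>] ordinal_ray_less_iff[of \<alpha> \<beta>] that
    by (fastforce simp: below_def topspace_octants coords_def)
  have "Lindelof_space (subtopology octants (octants closure_of below \<alpha>))" for \<alpha>
  proof -
    obtain \<beta> where \<beta>: "\<alpha> < \<beta>" using greater_omega1 by blast
    have "closedin (subtopology octants (below \<beta>)) (octants closure_of below \<alpha>)"
      using cl[OF \<beta>] by (simp add: closedin_subset_topspace)
    then have "Lindelof_space (subtopology (subtopology octants (below \<beta>)) (octants closure_of below \<alpha>))"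
      using Lindelof_below Lindelof_space_closedin_subtopology by blast
    then show ?thesis
      using cl[OF \<beta>] by (simp add: subtopology_subtopology inf.absorb2)
  qed
  then show ?thesis
    unfolding typeI_cover_def using below_cover openin_below cl by blast
qed

lemma not_Lindelof_octants: "\<not> Lindelof_space octants"
proof
  assume "Lindelof_space octants"
  then obtain b where b: "\<And>p. p \<in> topspace octants \<Longrightarrow> fst (coords p) < b"
    using Lindelof_imp_bounded_image continuous_map_level by blast
  obtain x where x: "max b ray0 < x" using greater_long_ray by blast
  then have "(0, x, ray0) \<in> topspace octants" by (simp add: topspace_octants)
  from b[OF this] show False using x by (auto simp: coords_def)
qed

lemma typeI_octants: "typeI_space octants"
  unfolding typeI_space_def using Hausdorff_octants typeI_cover_below not_Lindelof_octants by blast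

lemma bounded_in_octants_iff:
  assumes "A \<subseteq> topspace octants"
  shows "bounded_in octants A \<longleftrightarrow> (\<exists>b. \<forall>(n, x, y) \<in> A. x \<le> b)"
proof
  assume "bounded_in octants A"
  then show "\<exists>b. \<forall>(n, x, y) \<in> A. x \<le> b"
    unfolding bounded_in_iff[OF typeI_cover_below] below_def by (blast intro: less_imp_le)
next
  assume "\<exists>b. \<forall>(n, x, y) \<in> A. x \<le> b"
  then obtain b where b: "\<forall>(n, x, y) \<in> A. x \<le> b" by blast
  obtain \<alpha> where "b < ordinal_ray \<alpha>" using countable_bounded_long_ray[of "{b}"] by auto
  then have "A \<subseteq> below \<alpha>" using b assms by (fastforce simp: below_def topspace_octants)
  then show "bounded_in octants A" using bounded_in_iff[OF typeI_cover_below] by blast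
qed

text \<open>The levels up to \<open>a\<close> lie in a Lindelof strip. Unboundedness of a function
  can thus only come from arbitrarily high levels.\<close>

lemma continuous_bounded_on_levels:
  fixes f :: "_ \<Rightarrow> long_ray"
  assumes "continuous_map octants euclidean f"
  obtains b where "\<And>n x y. y < x \<Longrightarrow> x \<le> a \<Longrightarrow> f (n, x, y) < b"
proof -
  obtain \<alpha> where \<alpha>: "a < ordinal_ray \<alpha>" using countable_bounded_long_ray[of "{a}"] by auto
  obtain b where b: "\<And>p. p \<in> topspace (subtopology octants (below \<alpha>)) \<Longrightarrow> f p < b"
    using Lindelof_imp_bounded_image[OF Lindelof_below continuous_map_from_subtopology[OF assms]]
    by blast
  show thesis
    by (rule that[of b], rule b) (use \<alpha> in \<open>auto simp: topspace_octants below_def\<close>)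
qed

section \<open>Clubs and unbounded functions along rays\<close>

lemma oct_less: "y < x \<Longrightarrow> oct n x y = (n, x, y)"
  by (simp add: oct_def)

lemma oct_diagonal: "oct n s s = (n + 1, s, ray0)"
  by (simp add: oct_def)

text \<open>The limit may lie on the diagonal, that is, in the next octant. This and its analogue
  for closed sets carry information from one octant to the next.\<close>

lemma oct_tendsto:
  fixes f :: "int \<times> long_ray \<times> long_ray \<Rightarrow> long_ray"
  assumes f: "continuous_map octants euclidean f"
    and lim: "X \<longlonglongrightarrow> x" "Y \<longlonglongrightarrow> y" and le: "\<And>k. Y k \<le> X k" "\<And>k. ray0 < X k" "ray0 < x"
  shows "(\<lambda>k::nat. f (oct n (X k) (Y k))) \<longlonglongrightarrow> f (oct n x y)"
proof -
  let ?T = "{(x, y). y \<le> x \<and> ray0 < x}"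
  have "y \<le> x" using lim le(1) by (blast intro: LIMSEQ_le)
  have "continuous_on ?T (f \<circ> (\<lambda>(x, y). oct n x y))"
    using continuous_map_compose[OF continuous_map_oct f] by simp
  moreover have "(\<lambda>k. (X k, Y k)) \<longlonglongrightarrow> (x, y)" using lim by (rule tendsto_Pair)
  ultimately have "(\<lambda>k. (f \<circ> (\<lambda>(x, y). oct n x y)) (X k, Y k)) \<longlonglongrightarrow> (f \<circ> (\<lambda>(x, y). oct n x y)) (x, y)"
    by (rule continuous_on_tendsto_compose) (use le \<open>y \<le> x\<close> in auto)
  then show ?thesis by simp
qed

lemma closedin_oct_limit:
  assumes C: "closedin octants C"
    and lim: "X \<longlonglongrightarrow> x" "Y \<longlonglongrightarrow> y" and le: "\<And>k. Y k \<le> X k" "\<And>k. ray0 < X k" "ray0 < x"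
    and mem: "\<And>k::nat. oct n (X k) (Y k) \<in> C"
  shows "oct n x y \<in> C"
proof -
  let ?T = "{(x, y). y \<le> x \<and> ray0 < x}"
  have "y \<le> x" using lim le(1) by (blast intro: LIMSEQ_le)
  have "closedin (top_of_set ?T) {t \<in> topspace (top_of_set ?T). (case t of (x, y) \<Rightarrow> oct n x y) \<in> C}"
    by (rule closedin_continuous_map_preimage[OF continuous_map_oct C])
  then obtain K where K: "closed K" "{t \<in> ?T. (case t of (x, y) \<Rightarrow> oct n x y) \<in> C} = ?T \<inter> K"
    by (auto simp: closedin_closed)
  have K_iff: "oct n x y \<in> C \<longleftrightarrow> (x, y) \<in> K" if "y \<le> x" "ray0 < x" for x y
  proof -
    have "(x, y) \<in> {t \<in> ?T. (case t of (x, y) \<Rightarrow> oct n x y) \<in> C} \<longleftrightarrow> (x, y) \<in> ?T \<inter> K"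
      by (simp only: K(2))
    then show ?thesis using that by simp
  qed
  have "(X k, Y k) \<in> K" for k using K_iff mem[of k] le(1,2)[of k] by blast
  moreover have "(\<lambda>k. (X k, Y k)) \<longlonglongrightarrow> (x, y)" using lim by (rule tendsto_Pair)
  ultimately have "(x, y) \<in> K"
    by (intro Lim_in_closed_set[OF K(1), of "\<lambda>k. (X k, Y k)" sequentially]) auto
  then show ?thesis using K_iff[OF \<open>y \<le> x\<close> le(3)] by blast
qed

text \<open>Iterating the choice gives an increasing sequence, which converges in the long ray.
  Later uses encode in \<open>R\<close> that suitable points lie between consecutive terms or have
  these as coordinates.\<close>

lemma leapfrog:
  fixes R :: "long_ray \<Rightarrow> long_ray \<Rightarrow> bool"
  assumes "\<And>a. \<exists>b>a. R a b"
  obtains X s where "X \<longlonglongrightarrow> s" "\<And>k. a \<le> X k" "\<And>k. X k < X (Suc k)" "\<And>k. X k < s"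
    "\<And>k::nat. R (X k) (X (Suc k))"
proof -
  obtain X where X: "\<And>k. a \<le> X k" "\<And>k::nat. X k < X (Suc k) \<and> R (X k) (X (Suc k))"
  proof -
    have "\<exists>X. \<forall>k. a \<le> X k \<and> X k < X (Suc k) \<and> R (X k) (X (Suc k))"
    proof (rule dependent_nat_choice)
      show "\<exists>y. a \<le> y \<and> x < y \<and> R x y" if "a \<le> x" for x and n :: nat
        using assms[of x] that by (meson less_imp_le le_less_trans)
    qed blast
    then show ?thesis using that by blast
  qed
  then have "incseq X" by (intro incseq_SucI less_imp_le) blast
  then obtain s where s: "X \<longlonglongrightarrow> s" "\<And>k. X k \<le> s" by (rule incseq_long_ray_converges) blast
  have "X k < s" for k using X(2)[of k] s(2)[of "Suc k"] by (meson less_le_trans)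
  then show thesis using that[OF s(1) X(1)] X(2) by blast
qed

text \<open>Interleaved points of the two clubs have a common limit.\<close>

lemma clubs_on_ray_intersect:
  assumes C: "closedin octants C" "\<And>a. \<exists>x>a. y < x \<and> (n, x, y) \<in> C"
    and D: "closedin octants D" "\<And>a. \<exists>x>a. y < x \<and> (n, x, y) \<in> D"
  shows "\<exists>x>a. y < x \<and> (n, x, y) \<in> C \<inter> D"
proof -
  define R where "R a b E \<longleftrightarrow> (\<exists>c. a < c \<and> c < b \<and> y < c \<and> (n, c, y) \<in> E)"
    for a b and E :: "(int \<times> long_ray \<times> long_ray) set"
  have ex: "\<exists>b>a. R a b C \<and> R a b D" for a
  proof -
    obtain c d where cd: "a < c" "y < c" "(n, c, y) \<in> C" "a < d" "y < d" "(n, d, y) \<in> D"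
      using C(2)[of a] D(2)[of a] by blast
    obtain b where "max c d < b" using greater_long_ray by blast
    then have "c < b" "d < b" by auto
    then show ?thesis using cd unfolding R_def by (meson less_trans)
  qed
  obtain X s where X: "X \<longlonglongrightarrow> s" "\<And>k. max a y \<le> X k" "\<And>k. X k < s"
      "\<And>k::nat. R (X k) (X (Suc k)) C \<and> R (X k) (X (Suc k)) D"
    by (rule leapfrog[of "\<lambda>a b. R a b C \<and> R a b D", OF ex]) blast
  have s: "a < s" "y < s" using X(2)[of 0] X(3)[of 0] by (auto intro: le_less_trans)
  have lim: "(n, s, y) \<in> E"
    if E: "closedin octants E" "\<And>k. R (X k) (X (Suc k)) E" for E
  proof -
    from E(2) obtain Z where Z: "\<And>k. X k < Z k \<and> Z k < X (Suc k) \<and> y < Z k \<and> (n, Z k, y) \<in> E"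
      unfolding R_def by metis
    have "Z \<longlonglongrightarrow> s"
      by (rule tendsto_sandwich[OF _ _ X(1) LIMSEQ_Suc[OF X(1)]])
        (use Z in \<open>auto intro: less_imp_le always_eventually\<close>)
    then have "oct n s y \<in> E"
      by (rule closedin_oct_limit[OF E(1) _ tendsto_const])
        (use Z s ray0_le in \<open>auto simp: oct_less intro: less_imp_le le_less_trans\<close>)
    then show ?thesis using s by (simp add: oct_less)
  qed
  have "(n, s, y) \<in> C" "(n, s, y) \<in> D" using lim C(1) D(1) X(4) by blast+
  then show ?thesis using s by blast
qed

section \<open>Functions unbounded along a horizontal ray\<close>

definition ubd :: "(int \<times> long_ray \<times> long_ray \<Rightarrow> long_ray) \<Rightarrow> int \<Rightarrow> long_ray \<Rightarrow> bool" where
  "ubd f n y \<longleftrightarrow> (\<forall>b. \<exists>x>y. b < f (n, x, y))"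

lemma ubd_far:
  fixes f :: "int \<times> long_ray \<times> long_ray \<Rightarrow> long_ray"
  assumes f: "continuous_map octants euclidean f" and u: "ubd f n y"
  shows "\<exists>x>a. y < x \<and> b < f (n, x, y)"
proof -
  obtain c where c: "\<And>n x y. y < x \<Longrightarrow> x \<le> a \<Longrightarrow> f (n, x, y) < c"
    using continuous_bounded_on_levels[OF f] by blast
  obtain x where x: "y < x" "max b c < f (n, x, y)" using u unfolding ubd_def by blast
  then have "\<not> x \<le> a" using c[of y x n] by auto
  then show ?thesis using x by (intro exI[of _ x]) auto
qed

text \<open>The set where \<open>f\<close> is at least \<open>b\<close> is closed and reaches
  arbitrarily far along the ray, so it meets any other such set.\<close>

lemma ubd_on_club:
  fixes f :: "int \<times> long_ray \<times> long_ray \<Rightarrow> long_ray"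
  assumes f: "continuous_map octants euclidean f" and u: "ubd f n y"
    and C: "closedin octants C" "\<And>a. \<exists>x>a. y < x \<and> (n, x, y) \<in> C"
  shows "\<exists>x>a. y < x \<and> (n, x, y) \<in> C \<and> b \<le> f (n, x, y)"
proof -
  let ?D = "{p \<in> topspace octants. f p \<in> {b..}}"
  have D: "closedin octants ?D" by (rule closedin_continuous_map_preimage[OF f]) simp
  have D': "\<exists>x>a. y < x \<and> (n, x, y) \<in> ?D" for a
    using ubd_far[OF f u, of a b] by (auto simp: topspace_octants intro: less_imp_le)
  from clubs_on_ray_intersect[OF C D D', of a] show ?thesis by auto
qed

text \<open>Otherwise the set where \<open>f\<close> is at most \<open>b\<close> would be unbounded
  along the ray, and \<open>f\<close> would have to exceed \<open>b\<close> somewhere on it.\<close>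

lemma ubd_tail:
  fixes f :: "int \<times> long_ray \<times> long_ray \<Rightarrow> long_ray"
  assumes f: "continuous_map octants euclidean f" and u: "ubd f n y"
  shows "\<exists>a. \<forall>x. a < x \<longrightarrow> y < x \<longrightarrow> b \<le> f (n, x, y)"
proof (rule ccontr)
  assume no: "\<not> ?thesis"
  let ?C = "{p \<in> topspace octants. f p \<in> {..b}}"
  obtain c where c: "b < c" using greater_long_ray by blast
  have "closedin octants ?C" by (rule closedin_continuous_map_preimage[OF f]) simp
  moreover have "\<exists>x>a. y < x \<and> (n, x, y) \<in> ?C" for a
    using no by (fastforce simp: topspace_octants not_le intro: less_imp_le)
  ultimately have "\<exists>x>y. y < x \<and> (n, x, y) \<in> ?C \<and> c \<le> f (n, x, y)"
    by (rule ubd_on_club[OF f u])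
  then show False using c by auto
qed

text \<open>Sequential closedness of both alternatives rests on countable sets being bounded: in the
  first case the thresholds of the tails at the heights \<open>Y k\<close> have a common bound, in
  the second the bounds of \<open>f\<close> on these rays do.\<close>

lemma ubd_limit:
  fixes f :: "int \<times> long_ray \<times> long_ray \<Rightarrow> long_ray"
  assumes f: "continuous_map octants euclidean f" and lim: "Y \<longlonglongrightarrow> y"
  shows "(\<And>k::nat. ubd f n (Y k)) \<Longrightarrow> ubd f n y" and "(\<And>k. \<not> ubd f n (Y k)) \<Longrightarrow> \<not> ubd f n y"
proof -
  \<comment> \<open>From level \<open>c\<close> on, all the heights involved lie strictly below the
    diagonal.\<close>
  obtain c where c: "\<And>x. x \<in> insert y (range Y) \<Longrightarrow> x < c"
    using countable_bounded_long_ray[of "insert y (range Y)"] by auto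
  have tends: "(\<lambda>k. f (n, x, Y k)) \<longlonglongrightarrow> f (n, x, y)" if "c \<le> x" for x
  proof -
    have less: "y < x" "\<And>k. Y k < x" using c that by (auto intro: less_le_trans)
    have "(\<lambda>k. f (oct n x (Y k))) \<longlonglongrightarrow> f (oct n x y)"
      by (rule oct_tendsto[OF f tendsto_const lim])
        (use less ray0_le in \<open>auto intro: less_imp_le le_less_trans\<close>)
    then show ?thesis using less by (simp add: oct_less)
  qed
  show "ubd f n y" if u: "\<And>k. ubd f n (Y k)"
    unfolding ubd_def
  proof
    fix b :: long_ray
    obtain b' where b': "b < b'" using greater_long_ray by blast
    have "\<exists>a. \<forall>x. a < x \<longrightarrow> Y k < x \<longrightarrow> b' \<le> f (n, x, Y k)" for k
      using ubd_tail[OF f u[of k], of b'] .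
    then obtain A where A: "\<And>k x. A k < x \<Longrightarrow> Y k < x \<Longrightarrow> b' \<le> f (n, x, Y k)" by metis
    obtain d where d: "\<And>x. x \<in> insert c (range A) \<Longrightarrow> x < d"
      using countable_bounded_long_ray[of "insert c (range A)"] by auto
    have "c < d" "\<And>k. A k < d" "y < c" "\<And>k. Y k < c" using c d by auto
    then have "b' \<le> f (n, d, Y k)" for k using A by (meson less_trans)
    then have "b' \<le> f (n, d, y)"
      using tends[of d] \<open>c < d\<close> by (meson LIMSEQ_le_const less_imp_le)
    then show "\<exists>x>y. b < f (n, x, y)" using b' \<open>y < c\<close> \<open>c < d\<close> by (meson less_le_trans less_trans)
  qed
  show "\<not> ubd f n y" if u: "\<And>k. \<not> ubd f n (Y k)"
  proof
    assume uy: "ubd f n y"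
    from u obtain B where B: "\<And>k x. Y k < x \<Longrightarrow> f (n, x, Y k) \<le> B k"
      unfolding ubd_def by (metis not_less)
    obtain b where b: "\<And>x. x \<in> range B \<Longrightarrow> x < b"
      using countable_bounded_long_ray[of "range B"] by auto
    obtain x where x: "c < x" "b < f (n, x, y)" using ubd_far[OF f uy] by blast
    have "f (n, x, Y k) \<le> b" for k
      using B[of k x] b[of "B k"] c[of "Y k"] x by (auto intro: less_trans order_trans less_imp_le)
    then have "f (n, x, y) \<le> b" using tends[of x] x(1) by (meson LIMSEQ_le_const2 less_imp_le)
    then show False using x by simp
  qed
qed

text \<open>In a chart, the heights with an unbounded ray and those with a bounded one split an
  interval into two closed sets; connectedness excludes that both are nonempty.\<close>

lemma ubd_height_irrelevant:
  fixes f :: "int \<times> long_ray \<times> long_ray \<Rightarrow> long_ray"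
  assumes f: "continuous_map octants euclidean f" and u: "ubd f n y"
  shows "ubd f n y'"
proof (rule ccontr)
  assume u': "\<not> ubd f n y'"
  obtain \<alpha> where \<alpha>: "max y y' < ordinal_ray \<alpha>"
    using countable_bounded_long_ray[of "{max y y'}"] by auto
  obtain h g W where c: "ray_chart \<alpha> h g W" by (rule ray_chart_exists)
  define c where "c = h (max y y')"
  have "c < W" using c \<alpha> unfolding ray_chart_def c_def by blast
  then have cW: "{0..c} \<subseteq> {0..<W}" by auto
  then have "continuous_on {0..c} g" using c continuous_on_subset by (auto simp: ray_chart_def)
  then have g: "(\<lambda>k. g (T k)) \<longlonglongrightarrow> g t"
    if "\<And>k::nat. T k \<in> {0..c}" "T \<longlonglongrightarrow> t" "t \<in> {0..c}" for T t
    using that by (intro continuous_on_tendsto_compose[of "{0..c}" g]) (auto intro: always_eventually)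
  have cl: "closed {t \<in> {0..c}. P (g t)}"
    if P: "\<And>Y y. (\<And>k::nat. P (Y k)) \<Longrightarrow> Y \<longlonglongrightarrow> y \<Longrightarrow> P y" for P
    unfolding closed_sequential_limits
  proof (intro allI impI)
    fix T t assume T: "(\<forall>k. T k \<in> {t \<in> {0..c}. P (g t)}) \<and> T \<longlonglongrightarrow> t"
    then have "t \<in> {0..c}" using closed_atLeastAtMost[of 0 c] unfolding closed_sequential_limits by blast
    moreover have "P (g t)" using P[of "\<lambda>k. g (T k)" "g t"] g[of T t] T calculation by auto
    ultimately show "t \<in> {t \<in> {0..c}. P (g t)}" by simp
  qed
  have mem: "h z \<in> {0..c} \<and> g (h z) = z" if "z \<le> max y y'" for z
    using c \<alpha> that unfolding c_def ray_chart_def by (metis atLeastAtMost_iff le_less_trans not_less)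
  define A B where "A = {t \<in> {0..c}. ubd f n (g t)}" and "B = {t \<in> {0..c}. \<not> ubd f n (g t)}"
  have "closed A" "closed B"
    using ubd_limit[OF f] cl[of "ubd f n"] cl[of "\<lambda>y. \<not> ubd f n y"] unfolding A_def B_def by blast+
  moreover have "h y \<in> A" "h y' \<in> B" using mem[of y] mem[of y'] u u' by (auto simp: A_def B_def)
  moreover have "{0..c} = A \<union> B" "A \<inter> B = {}" by (auto simp: A_def B_def)
  moreover have "connected {0..c}" by simp
  ultimately show False unfolding connected_closed by blast
qed

lemma ubd_next_octant:
  fixes f :: "int \<times> long_ray \<times> long_ray \<Rightarrow> long_ray"
  assumes f: "continuous_map octants euclidean f" and u: "ubd f n y"
  shows "ubd f (n + 1) y'"
proof -
  have "ubd f (n + 1) ray0"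
    unfolding ubd_def
  proof
    fix b :: long_ray
    obtain b' where b': "b < b'" using greater_long_ray by blast
    \<comment> \<open>The height is taken equal to the level \<open>a\<close> to be exceeded.
      Leapfrogging then makes each level the next height, so both converge to the same
      \<open>s\<close> and the limit is a diagonal point.\<close>
    have "\<exists>x>a. b' \<le> f (n, x, a)" for a
      using ubd_far[OF f ubd_height_irrelevant[OF f u, of a], of a b'] less_imp_le by blast
    then obtain X s where X: "X \<longlonglongrightarrow> s" "\<And>k. X k < X (Suc k)" "\<And>k. X k < s"
      "\<And>k::nat. b' \<le> f (n, X (Suc k), X k)"
      using leapfrog[of "\<lambda>a x. b' \<le> f (n, x, a)"] by metis
    have s: "ray0 < s" using X(3)[of 0] ray0_le by (meson le_less_trans)
    have "(\<lambda>k. f (oct n (X (Suc k)) (X k))) \<longlonglongrightarrow> f (oct n s s)"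
      by (rule oct_tendsto[OF f LIMSEQ_Suc[OF X(1)] X(1)])
        (use X(2) s ray0_le in \<open>auto intro: less_imp_le le_less_trans\<close>)
    then have "(\<lambda>k. f (n, X (Suc k), X k)) \<longlonglongrightarrow> f (n + 1, s, ray0)"
      using X(2) by (simp add: oct_less oct_diagonal)
    then have "b' \<le> f (n + 1, s, ray0)" using X(4) by (meson LIMSEQ_le_const)
    then show "\<exists>x>ray0. b < f (n + 1, x, ray0)" using s b' less_le_trans by blast
  qed
  then show ?thesis by (rule ubd_height_irrelevant[OF f])
qed

lemma ubd_mono:
  fixes f :: "int \<times> long_ray \<times> long_ray \<Rightarrow> long_ray"
  assumes f: "continuous_map octants euclidean f" and u: "ubd f m y" and "m \<le> n"
  shows "ubd f n y'"
proof -
  have "ubd f n y" using \<open>m \<le> n\<close>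
    by (induction rule: int_ge_induct) (use u ubd_next_octant[OF f] in auto)
  then show ?thesis by (rule ubd_height_irrelevant[OF f])
qed

section \<open>Directions\<close>

lemma club_in_octants_iff:
  "club_in octants C \<longleftrightarrow> closedin octants C \<and> (\<forall>b. \<exists>n x y. (n, x, y) \<in> C \<and> b < x)"
proof (cases "closedin octants C")
  case True
  then have "C \<subseteq> topspace octants" by (rule closedin_subset)
  moreover have "(\<forall>(n, x, y) \<in> C. x \<le> b) \<longleftrightarrow> \<not> (\<exists>n x y. (n, x, y) \<in> C \<and> b < x)" for b
    by (auto simp: not_less)
  ultimately show ?thesis
    using True bounded_in_octants_iff[of C] by (simp add: club_in_def)
qed (simp add: club_in_def)

text \<open>There are only countably many octants, so bounds for \<open>C\<close> in each of them
  would have a common bound.\<close>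

lemma club_meets_octant:
  assumes "club_in octants C"
  obtains n where "\<And>b. \<exists>x y. (n, x, y) \<in> C \<and> b < x"
proof (rule ccontr)
  assume "\<not> thesis"
  then have "\<forall>n. \<exists>b. \<forall>x y. (n, x, y) \<in> C \<longrightarrow> x \<le> b" using that by (meson not_le)
  then obtain B where B: "\<And>n x y. (n, x, y) \<in> C \<Longrightarrow> x \<le> B n" by metis
  obtain b where b: "\<And>n. B n < b"
    using countable_bounded_long_ray[of "range B"] by (metis countableI_type countable_image rangeI)
  obtain n x y where "(n, x, y) \<in> C" "b < x" using assms unfolding club_in_octants_iff by blast
  then show False using B[of n x y] b[of n] by auto
qed

text \<open>Heights up to \<open>c\<close> form a compact interval, so some height is approached by
  points of \<open>C\<close> at arbitrarily high levels. Limits of sequences with increasing levels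
  lie in \<open>C\<close> at exactly that height.\<close>

lemma bounded_height_club_meets_ray:
  assumes C: "closedin octants C"
    and far: "\<And>b. \<exists>x y. (n, x, y) \<in> C \<and> y \<le> c \<and> b < x"
  obtains y where "\<And>a. \<exists>x>a. y < x \<and> (n, x, y) \<in> C"
proof -
  obtain \<alpha> where \<alpha>: "c < ordinal_ray \<alpha>" using countable_bounded_long_ray[of "{c}"] by auto
  obtain h g W where ch: "ray_chart \<alpha> h g W" by (rule ray_chart_exists)
  let ?K = "{0..h c}"
  have hc: "h c < W" using ch \<alpha> unfolding ray_chart_def by blast
  have h: "h y \<in> ?K \<and> g (h y) = y" if "y \<le> c" for y
    using ch \<alpha> that unfolding ray_chart_def by (metis atLeastAtMost_iff le_less_trans not_less)
  have "\<exists>t\<in>?K. \<forall>e>0. \<forall>b. \<exists>x y. (n, x, y) \<in> C \<and> y \<le> c \<and> b < x \<and> \<bar>h y - t\<bar> < e"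
  proof (rule ccontr)
    assume "\<not> ?thesis"
    then have "\<forall>t\<in>?K. \<exists>e>0. \<exists>b. \<forall>x y. (n, x, y) \<in> C \<longrightarrow> y \<le> c \<longrightarrow> \<bar>h y - t\<bar> < e \<longrightarrow> x \<le> b"
      by (meson not_le)
    then obtain e where e: "\<And>t. t \<in> ?K \<Longrightarrow> 0 < e t"
      "\<And>t. t \<in> ?K \<Longrightarrow> \<exists>b. \<forall>x y. (n, x, y) \<in> C \<longrightarrow> y \<le> c \<longrightarrow> \<bar>h y - t\<bar> < e t \<longrightarrow> x \<le> b"
      by metis
    then obtain B where B: "\<And>t x y. t \<in> ?K \<Longrightarrow> (n, x, y) \<in> C \<Longrightarrow> y \<le> c \<Longrightarrow> \<bar>h y - t\<bar> < e t \<Longrightarrow> x \<le> B t"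
      by metis
    \<comment> \<open>A finite subcover leaves finitely many level bounds, which together would
      bound all points of \<open>C\<close> of height at most \<open>c\<close>.\<close>
    obtain F where F: "F \<subseteq> ?K" "finite F" "?K \<subseteq> (\<Union>t\<in>F. ball t (e t))"
      by (rule compactE_image[of ?K ?K "\<lambda>t. ball t (e t)"]) (use e(1) in auto)
    obtain b where b: "\<And>t. t \<in> F \<Longrightarrow> B t < b"
      using countable_bounded_long_ray[of "B ` F"] F(2)
      by (metis countable_finite finite_imageI imageI)
    obtain x y where xy: "(n, x, y) \<in> C" "y \<le> c" "b < x" using far by blast
    then obtain t where t: "t \<in> F" "h y \<in> ball t (e t)" using h F(3) by blast
    then have "\<bar>h y - t\<bar> < e t" by (simp add: dist_real_def abs_minus_commute)
    then have "x \<le> B t" using B xy t F(1) by blast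
    then show False using b[OF t(1)] xy(3) by simp
  qed
  then obtain t where t: "t \<in> ?K"
    and near: "\<And>e b. 0 < e \<Longrightarrow> \<exists>x y. (n, x, y) \<in> C \<and> y \<le> c \<and> b < x \<and> \<bar>h y - t\<bar> < e"
    by blast
  have "\<exists>x>a. g t < x \<and> (n, x, g t) \<in> C" for a
  proof -
    \<comment> \<open>Levels above both \<open>c\<close> and \<open>g t\<close> keep the sequence
      and its limit off the diagonal.\<close>
    define a' where "a' = max a (max c (g t))"
    have "\<exists>Z. \<forall>k. ((n, fst (Z k), snd (Z k)) \<in> C \<and> snd (Z k) \<le> c \<and> a' < fst (Z k) \<and>
        \<bar>h (snd (Z k)) - t\<bar> < 1 / real (Suc k)) \<and> fst (Z k) < fst (Z (Suc k))"
    proof (rule dependent_nat_choice)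
      show "\<exists>z. (n, fst z, snd z) \<in> C \<and> snd z \<le> c \<and> a' < fst z \<and> \<bar>h (snd z) - t\<bar> < 1 / real (Suc 0)"
        using near[of 1 a'] by auto
    next
      fix z and k :: nat
      show "\<exists>z'. ((n, fst z', snd z') \<in> C \<and> snd z' \<le> c \<and> a' < fst z' \<and>
          \<bar>h (snd z') - t\<bar> < 1 / real (Suc (Suc k))) \<and> fst z < fst z'"
        using near[of "1 / real (Suc (Suc k))" "max a' (fst z)"] by auto
    qed
    then obtain Z where Z: "\<And>k. (n, fst (Z k), snd (Z k)) \<in> C" "\<And>k. snd (Z k) \<le> c" "\<And>k. a' < fst (Z k)"
      "\<And>k. \<bar>h (snd (Z k)) - t\<bar> < 1 / real (Suc k)" "\<And>k. fst (Z k) < fst (Z (Suc k))" by metis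
    have "incseq (\<lambda>k. fst (Z k))" using Z(5) by (intro incseq_SucI less_imp_le)
    then obtain s where s: "(\<lambda>k. fst (Z k)) \<longlonglongrightarrow> s" "\<And>k. fst (Z k) \<le> s"
      by (rule incseq_long_ray_converges) blast
    have "(\<lambda>k. h (snd (Z k)) - t) \<longlonglongrightarrow> 0"
      by (rule Lim_null_comparison[OF _ LIMSEQ_inverse_real_of_nat])
        (use Z(4) in \<open>auto simp: inverse_eq_divide intro!: always_eventually less_imp_le\<close>)
    then have "(\<lambda>k. h (snd (Z k))) \<longlonglongrightarrow> t" by (rule LIM_zero_cancel)
    moreover have "continuous_on {0..<W} g" using ch by (simp add: ray_chart_def)
    ultimately have "(\<lambda>k. g (h (snd (Z k)))) \<longlonglongrightarrow> g t"
      using t hc h Z(2)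
      by (intro continuous_on_tendsto_compose[of "{0..<W}" g]) (auto intro: always_eventually le_less_trans)
    then have lim: "(\<lambda>k. snd (Z k)) \<longlonglongrightarrow> g t" using h Z(2) by simp
    have s': "a' < s" using Z(3)[of 0] s(2)[of 0] by simp
    have less: "snd (Z k) < fst (Z k)" for k using Z(2,3)[of k] by (auto simp: a'_def)
    have "oct n s (g t) \<in> C"
      by (rule closedin_oct_limit[OF C s(1) lim])
        (use Z(1) less s' ray0_le in \<open>auto simp: oct_less intro: less_imp_le le_less_trans\<close>)
    then show ?thesis using s' by (auto simp: a'_def oct_less)
  qed
  then show thesis by (rule that)
qed

text \<open>If \<open>C\<close> has no unbounded part of bounded height, a leapfrog argument finds points of \<open>C\<close> on the
  diagonal of the octant, which is a ray of the next octant.\<close>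

lemma club_meets_ray:
  assumes C: "club_in octants C"
  obtains n y where "\<And>a. \<exists>x>a. y < x \<and> (n, x, y) \<in> C"
proof -
  have cl: "closedin octants C" using C by (simp add: club_in_def)
  obtain n where n: "\<And>b. \<exists>x y. (n, x, y) \<in> C \<and> b < x" using club_meets_octant[OF C] by blast
  have less: "y < x" if "(m, x, y) \<in> C" for m x y
    using closedin_subset[OF cl] that by (auto simp: topspace_octants)
  show thesis
  proof (cases "\<exists>c. \<forall>b. \<exists>x y. (n, x, y) \<in> C \<and> y \<le> c \<and> b < x")
    case True
    then show ?thesis using bounded_height_club_meets_ray[OF cl] that by metis
  next
    case False
    \<comment> \<open>Points of height at most \<open>a\<close> have bounded level, so a point of
      sufficiently high level also has height above \<open>a\<close>. Height and level are thus
      squeezed between consecutive leapfrog terms.\<close>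
    have step: "\<exists>b>a. \<exists>x y. a < y \<and> y < x \<and> x < b \<and> (n, x, y) \<in> C" for a
    proof -
      obtain b where b: "\<And>x y. (n, x, y) \<in> C \<Longrightarrow> y \<le> a \<Longrightarrow> x \<le> b" using False by (meson not_le)
      obtain x y where xy: "(n, x, y) \<in> C" "b < x" using n by blast
      then have "a < y" "y < x" using b[of x y] less by (auto simp: not_le[symmetric])
      moreover obtain d where "x < d" using greater_long_ray by blast
      ultimately show ?thesis using xy by (meson less_trans)
    qed
    have "\<exists>x>a. ray0 < x \<and> (n + 1, x, ray0) \<in> C" for a
    proof -
      obtain X s where X: "X \<longlonglongrightarrow> s" "\<And>k. a \<le> X k" "\<And>k. X k < s"
        "\<And>k::nat. \<exists>x y. X k < y \<and> y < x \<and> x < X (Suc k) \<and> (n, x, y) \<in> C"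
        by (rule leapfrog[of "\<lambda>a b. \<exists>x y. a < y \<and> y < x \<and> x < b \<and> (n, x, y) \<in> C", OF step]) blast
      then obtain U V where UV: "\<And>k. X k < V k \<and> V k < U k \<and> U k < X (Suc k) \<and> (n, U k, V k) \<in> C"
        by metis
      then have "\<And>k. X k \<le> V k" "\<And>k. V k \<le> X (Suc k)" "\<And>k. X k \<le> U k" "\<And>k. U k \<le> X (Suc k)"
        by (meson less_imp_le less_trans)+
      then have lim: "U \<longlonglongrightarrow> s" "V \<longlonglongrightarrow> s"
        using tendsto_sandwich[OF _ _ X(1) LIMSEQ_Suc[OF X(1)]] by (simp_all add: always_eventually)
      have as: "a < s" using X(2)[of 0] X(3)[of 0] by simp
      have "oct n s s \<in> C"
        by (rule closedin_oct_limit[OF cl lim])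
          (use UV as ray0_le in \<open>auto simp: oct_less intro: less_imp_le le_less_trans\<close>)
      then show ?thesis using as ray0_le by (auto simp: oct_diagonal intro: le_less_trans)
    qed
    then show ?thesis by (rule that)
  qed
qed

section \<open>Clubs on horizontal rays and the integer of a direction\<close>

definition ray :: "int \<Rightarrow> long_ray \<Rightarrow> long_ray \<Rightarrow> (int \<times> long_ray \<times> long_ray) set" where
  "ray n y a = {(m, x, z). m = n \<and> z = y \<and> a \<le> x}"

lemma closedin_ray:
  assumes "y < a"
  shows "closedin octants (ray n y a)"
proof -
  \<comment> \<open>Height \<open>y\<close> in the octant \<open>n\<close> rules out later octants,
    where it would equal the level. Full height in the octant \<open>n - 1\<close> rules out earlier
    ones, which matters when \<open>y = ray0\<close>.\<close>
  let ?Q = "{q :: long_ray \<times> (int \<Rightarrow> long_ray). a \<le> fst q \<and> snd q n = y \<and> snd q (n - 1) = fst q}"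
  have "continuous_on UNIV (\<lambda>q :: long_ray \<times> (int \<Rightarrow> long_ray). snd q k)" for k
    by (intro continuous_on_compose2[OF continuous_on_product_coordinates continuous_on_snd]
        continuous_on_id) simp
  then have "closed ?Q"
    by (intro closed_Collect_conj closed_Collect_le closed_Collect_eq continuous_on_fst
        continuous_on_id continuous_on_const)
  then have "closedin octants {p \<in> topspace octants. coords p \<in> ?Q}"
    by (intro closedin_continuous_map_preimage[OF continuous_map_coords]) simp
  moreover have "{p \<in> topspace octants. coords p \<in> ?Q} = ray n y a"
    using assms ray0_le[of y]
    by (auto simp: topspace_octants coords_def ray_def split: if_splits)
  ultimately show ?thesis by simp
qed

lemma club_in_ray_iff:
  assumes "E \<subseteq> ray n y a" "y < a"
  shows "club_in octants E \<longleftrightarrow> closedin octants E \<and> (\<forall>b. \<exists>x>b. y < x \<and> (n, x, y) \<in> E)"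
proof -
  have "(\<exists>m x z. (m, x, z) \<in> E \<and> b < x) \<longleftrightarrow> (\<exists>x>b. y < x \<and> (n, x, y) \<in> E)" for b
    using assms by (fastforce simp: ray_def)
  then show ?thesis unfolding club_in_octants_iff by simp
qed

lemma club_in_ray:
  assumes "y < a"
  shows "club_in octants (ray n y a)"
proof -
  have "\<exists>x>b. y < x \<and> (n, x, y) \<in> ray n y a" for b
  proof -
    obtain x where "max a b < x" using greater_long_ray by blast
    then show ?thesis using assms by (intro exI[of _ x]) (auto simp: ray_def)
  qed
  then show ?thesis using club_in_ray_iff[OF order_refl assms] closedin_ray[OF assms] by blast
qed

lemma club_contains_ray_club:
  assumes "club_in octants C"
  obtains n y a E where "y < a" "E \<subseteq> ray n y a" "club_in octants E" "E \<subseteq> C"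
proof -
  obtain n y where ny: "\<And>a. \<exists>x>a. y < x \<and> (n, x, y) \<in> C" using club_meets_ray[OF assms] by blast
  obtain a where a: "y < a" using greater_long_ray by blast
  have "\<exists>x>b. y < x \<and> (n, x, y) \<in> C \<inter> ray n y a" for b
    using ny[of "max a b"] by (auto simp: ray_def intro: less_imp_le)
  moreover have "closedin octants (C \<inter> ray n y a)"
    using assms closedin_ray[OF a] by (auto simp: club_in_def)
  ultimately have "club_in octants (C \<inter> ray n y a)"
    using club_in_ray_iff[of "C \<inter> ray n y a" n y a] a by blast
  then show thesis using that[OF a, of "C \<inter> ray n y a" n] by blast
qed

text \<open>The integer is read off from the functions unbounded on \<open>D\<close>. Height
  \<open>ray0\<close> is only a representative, by \<open>ubd_height_irrelevant\<close>.\<close>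

definition carried :: "int \<Rightarrow> (int \<times> long_ray \<times> long_ray) set \<Rightarrow> bool" where
  "carried n D \<longleftrightarrow> (\<forall>f. continuous_map octants euclidean f \<longrightarrow>
     (\<not> bounded_long_ray (f ` D) \<longleftrightarrow> ubd f n ray0))"

lemma carried_ray_club:
  assumes "y < a" "E \<subseteq> ray n y a" "club_in octants E"
  shows "carried n E"
  unfolding carried_def
proof (intro allI impI iffI)
  fix f :: "int \<times> long_ray \<times> long_ray \<Rightarrow> long_ray"
  assume f: "continuous_map octants euclidean f"
  {
    assume "\<not> bounded_long_ray (f ` E)"
    then have "\<exists>p\<in>E. b < f p" for b by (auto simp: bounded_long_ray_iff not_le)
    then have "\<exists>x>y. b < f (n, x, y)" for b
      using assms(1,2) unfolding ray_def by (blast intro: less_le_trans)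
    then have "ubd f n y" by (simp add: ubd_def)
    then show "ubd f n ray0" by (rule ubd_height_irrelevant[OF f])
  next
    assume "ubd f n ray0"
    then have u: "ubd f n y" by (rule ubd_height_irrelevant[OF f])
    show "\<not> bounded_long_ray (f ` E)"
    proof
      assume "bounded_long_ray (f ` E)"
      then obtain b where b: "\<forall>p\<in>E. f p \<le> b" by (auto simp: bounded_long_ray_iff)
      obtain b' where b': "b < b'" using greater_long_ray by blast
      have E: "closedin octants E" "\<And>a. \<exists>x>a. y < x \<and> (n, x, y) \<in> E"
        using club_in_ray_iff[OF assms(2,1)] assms(3) by blast+
      obtain x where "(n, x, y) \<in> E" "b' \<le> f (n, x, y)" using ubd_on_club[OF f u E] by blast
      then show False using b b' by (meson leD less_le_trans)
    qed
  }
qed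

text \<open>A club subset of \<open>E\<close> is a club on the same ray, hence carried by the same
  integer, and sets carried by one integer are ufo-equivalent.\<close>

lemma direction_ray_club:
  assumes "y < a" "E \<subseteq> ray n y a" "club_in octants E"
  shows "direction octants E"
  unfolding direction_def
proof (intro conjI allI impI assms(3))
  fix C assume C: "club_in octants C \<and> C \<subseteq> E"
  then have "carried n C" "carried n E"
    using assms carried_ray_club[of y a] by blast+
  then show "ufo_equiv octants E C" by (auto simp: ufo_equiv_def ufo_le_def carried_def)
qed

text \<open>A direction contains a club on some horizontal ray and is ufo-equivalent to it, so it
  inherits its integer.\<close>

lemma direction_carried:
  assumes "direction octants D"
  obtains n where "carried n D"
proof -
  have "club_in octants D" using assms by (simp add: direction_def)
  then obtain n y a E where E: "y < a" "E \<subseteq> ray n y a" "club_in octants E" "E \<subseteq> D"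
    by (rule club_contains_ray_club)
  then have "carried n E" "ufo_equiv octants D E"
    using carried_ray_club assms by (auto simp: direction_def)
  then have "carried n D" unfolding carried_def ufo_equiv_def ufo_le_def by blast
  then show thesis by (rule that)
qed

lemma ufo_le_carried_iff:
  assumes D: "carried m D" and E: "carried n E"
  shows "ufo_le octants D E \<longleftrightarrow> m \<le> n"
proof
  assume "m \<le> n"
  then show "ufo_le octants D E"
    using D E ubd_mono[of _ m ray0 n ray0] unfolding ufo_le_def carried_def by blast
next
  assume le: "ufo_le octants D E"
  show "m \<le> n"
  proof (rule ccontr)
    assume "\<not> m \<le> n"
    \<comment> \<open>This height equals the level on the octant \<open>m\<close> but is constantly
      \<open>ray0\<close> on the bottom ray of every earlier octant, so it separates the two
      sets.\<close>
    let ?f = "\<lambda>p. snd (coords p) (m - 1)"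
    have "ubd ?f m ray0"
      unfolding ubd_def
    proof
      fix b :: long_ray
      obtain x where "max b ray0 < x" using greater_long_ray by blast
      then show "\<exists>x>ray0. b < ?f (m, x, ray0)" by (intro exI[of _ x]) (auto simp: coords_def)
    qed
    moreover have "\<not> ubd ?f n ray0"
      using \<open>\<not> m \<le> n\<close> by (auto simp: ubd_def coords_def intro!: exI[of _ ray0])
    ultimately show False
      using le D E continuous_map_height unfolding ufo_le_def carried_def by blast
  qed
qed

section \<open>Closed discrete sets and the spanning property\<close>

lemma countable_discrete_Lindelof:
  assumes "Lindelof_space (discrete_topology C)"
  shows "countable C"
proof -
  have "\<exists>\<V>. countable \<V> \<and> \<V> \<subseteq> (\<lambda>x. {x}) ` C \<and> \<Union>\<V> = topspace (discrete_topology C)"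
    by (rule Lindelof_spaceD[OF assms]) auto
  then obtain \<V> where "countable \<V>" "\<V> \<subseteq> (\<lambda>x. {x}) ` C" "\<Union>\<V> = C" by auto
  then show ?thesis using countable_UN[of \<V> "\<lambda>A. A"] by (auto dest: subsetD)
qed

text \<open>An uncountable closed discrete set cannot lie in a Lindelof strip, so it is a club and
  meets some ray arbitrarily far. A limit of its points there contradicts discreteness.\<close>

lemma omega1_compact_octants: "omega1_compact octants"
  unfolding omega1_compact_def
proof
  assume "\<exists>C. closedin octants C \<and> subtopology octants C = discrete_topology C \<and> uncountable C"
  then obtain C where C: "closedin octants C" "subtopology octants C = discrete_topology C"
    "uncountable C" by blast
  have sub: "C \<subseteq> topspace octants" using C(1) by (rule closedin_subset)
  have closed_sub: "closedin octants B" if "B \<subseteq> C" for B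
  proof -
    have "closedin (subtopology octants C) B" using that C(2) by simp
    then show ?thesis using C(1) closedin_trans_full by blast
  qed
  have "\<not> bounded_in octants C"
  proof
    assume "bounded_in octants C"
    then obtain \<alpha> where \<alpha>: "C \<subseteq> below \<alpha>" using bounded_in_iff[OF typeI_cover_below] by blast
    have "closedin (subtopology octants (below \<alpha>)) C"
      using closedin_subset_topspace[OF C(1) \<alpha>] .
    then have "Lindelof_space (subtopology (subtopology octants (below \<alpha>)) C)"
      using Lindelof_below Lindelof_space_closedin_subtopology by blast
    then have "Lindelof_space (discrete_topology C)"
      using \<alpha> C(2) by (simp add: subtopology_subtopology inf.absorb2)
    then show False using C(3) countable_discrete_Lindelof by blast
  qed
  then have "club_in octants C" using C(1) by (simp add: club_in_def)
  then obtain n y where ny: "\<And>a. \<exists>x>a. y < x \<and> (n, x, y) \<in> C" using club_meets_ray by blast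
  obtain X s where X: "X \<longlonglongrightarrow> s" "\<And>k. y \<le> X k" "\<And>k. X k < s"
      "\<And>k::nat. \<exists>x. X k < x \<and> x < X (Suc k) \<and> y < x \<and> (n, x, y) \<in> C"
  proof (rule leapfrog[of "\<lambda>a b. \<exists>x. a < x \<and> x < b \<and> y < x \<and> (n, x, y) \<in> C"])
    show "\<exists>b>a. \<exists>x. a < x \<and> x < b \<and> y < x \<and> (n, x, y) \<in> C" for a
      using ny[of a] greater_long_ray by (meson less_trans)
  qed blast
  then obtain Z where Z: "\<And>k. X k < Z k \<and> Z k < X (Suc k) \<and> y < Z k \<and> (n, Z k, y) \<in> C" by metis
  then have "Z \<longlonglongrightarrow> s"
    by (intro tendsto_sandwich[OF _ _ X(1) LIMSEQ_Suc[OF X(1)]])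
      (auto intro: less_imp_le always_eventually)
  moreover have s: "y < s" using X(2)[of 0] X(3)[of 0] by simp
  \<comment> \<open>Every subset of \<open>C\<close> is closed, so deleting the limit point leaves a
    closed set that still contains the sequence and must contain its limit.\<close>
  moreover define B where "B = C - {(n, s, y)}"
  have "Z k < s" for k using Z[of k] X(3)[of "Suc k"] by (meson less_trans)
  then have "(n, Z k, y) \<in> B" for k using Z[of k] by (auto simp: B_def)
  ultimately have "oct n s y \<in> B"
    using Z s ray0_le
    by (intro closedin_oct_limit[OF closed_sub, of B Z s "\<lambda>_. y"])
      (auto simp: B_def oct_less intro: less_imp_le le_less_trans)
  then show False using s by (simp add: oct_less B_def)
qed

lemma spanned_octants: "spanned_by_directions octants"
  unfolding spanned_by_directions_def large_open_def
  by (meson club_contains_ray_club direction_ray_club order_trans)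

theorem theorem8p1:
  shows "\<exists>S :: (int \<times> long_ray \<times> long_ray) topology.
    surface S \<and> typeI_space S \<and> omega1_compact S \<and> spanned_by_directions S \<and>
    order_isomorphic (direction_classes S) (class_le S) (UNIV :: int set) (\<le>) \<and>
    \<not> (\<exists>D. ufo_minimal S D) \<and> \<not> (\<exists>D. ufo_maximal S D)"
proof -
  obtain a where a: "ray0 < a" using greater_long_ray by blast
  \<comment> \<open>The bottom rays of the octants represent the classes, one for each
    integer.\<close>
  define R where "R n = ray n ray0 a" for n
  define K where "K n = ufo_class octants (R n)" for n
  have R: "direction octants (R n)" "carried n (R n)" for n
    using direction_ray_club[OF a order_refl club_in_ray[OF a]]
      carried_ray_club[OF a order_refl club_in_ray[OF a]] by (simp_all add: R_def)
  have K_le: "class_le octants (K m) (K n) \<longleftrightarrow> m \<le> n" for m n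
    using class_le_ufo_class[OF R(1) R(1)] ufo_le_carried_iff[OF R(2) R(2)] by (simp add: K_def)
  \<comment> \<open>Being carried by \<open>n\<close> fixes which functions are unbounded on
    \<open>D\<close>, and hence the whole class.\<close>
  have K_class: "ufo_class octants D = K n" if "carried n D" for D n
  proof -
    have "bounded_long_ray (f ` D) \<longleftrightarrow> bounded_long_ray (f ` R n)"
      if "continuous_map octants euclidean f" for f
      using that \<open>carried n D\<close> R(2)[of n] unfolding carried_def by blast
    then have "ufo_equiv octants D E \<longleftrightarrow> ufo_equiv octants (R n) E" for E
      by (auto simp: ufo_equiv_def ufo_le_def)
    then show ?thesis by (simp add: K_def ufo_class_def)
  qed
  have K_mem: "K n \<in> direction_classes octants" for n
    using R(1) by (auto simp: direction_classes_def K_def)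
  have inj: "inj K"
  proof (rule injI)
    fix m n assume "K m = K n"
    then show "m = n" using K_le[of m n] K_le[of n m] K_le[of m m] by simp
  qed
  have range: "range K = direction_classes octants"
  proof (intro equalityI subsetI)
    fix P assume "P \<in> direction_classes octants"
    then obtain D where D: "direction octants D" "P = ufo_class octants D"
      by (auto simp: direction_classes_def)
    obtain n where "carried n D" by (rule direction_carried[OF D(1)])
    then show "P \<in> range K" using K_class D(2) by simp
  qed (use K_mem in blast)
  have "bij_betw K UNIV (direction_classes octants)" using inj range by (simp add: bij_betw_def)
  then have "bij_betw (inv K) (direction_classes octants) UNIV" by (rule bij_betw_inv_into)
  moreover have "\<forall>P\<in>direction_classes octants. \<forall>Q\<in>direction_classes octants.
      class_le octants P Q \<longleftrightarrow> inv K P \<le> inv K Q"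
    unfolding range[symmetric] using K_le by (simp add: inv_f_f[OF inj])
  ultimately have iso: "order_isomorphic (direction_classes octants) (class_le octants) (UNIV :: int set) (\<le>)"
    unfolding order_isomorphic_def by blast
  have no_min: "\<not> ufo_minimal octants D" for D
  proof
    assume D: "ufo_minimal octants D"
    then have "direction octants D" by (simp add: ufo_minimal_def)
    then obtain n where "carried n D" by (rule direction_carried)
    then have "ufo_class octants D = K n" by (rule K_class)
    \<comment> \<open>Minimality would identify the class with its predecessor, against injectivity
      of \<open>K\<close>.\<close>
    then have "K (n - 1) = K n"
      using D K_mem[of "n - 1"] K_le[of "n - 1" n] by (auto simp: ufo_minimal_def)
    then show False using inj by (simp add: inj_eq)
  qed
  have no_max: "\<not> ufo_maximal octants D" for D
  proof
    assume D: "ufo_maximal octants D"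
    then have "direction octants D" by (simp add: ufo_maximal_def)
    then obtain n where "carried n D" by (rule direction_carried)
    then have "ufo_class octants D = K n" by (rule K_class)
    then have "K (n + 1) = K n"
      using D K_mem[of "n + 1"] K_le[of n "n + 1"] by (auto simp: ufo_maximal_def)
    then show False using inj by (simp add: inj_eq)
  qed
  show ?thesis
    by (intro exI[of _ octants] conjI surface_octants typeI_octants omega1_compact_octants
        spanned_octants iso) (simp_all add: no_min no_max)
qed

end
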